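(* Let $K$ be a class of first-order models such that $K(\Theta)$ is first-order axiomatizable for every finite vocabulary $\Theta$, and let $\varphi(x,\bar{w}_n)$ be $K$-invariant with respect to asimulations. Then $\varphi(x,\bar{w}_n)$ is $K$-equivalent to a standard $x$-translation of an intuitionistic formula, i.e. to $ST(i(\bar{w}_n),x)$ for some intuitionistic formula $i(\bar{w}_n)$.
   Context: Let $\mathbb{N}=\{1,2,3,\dots\}$. $\Sigma$ is the first-order vocabulary consisting of two binary letters $R,E$ and letters $P^n_m$ ($n,m\in\mathbb{N}$) of arity $n$. Formulas are first-order formulas with identity over $\Sigma$. A vocabulary $\Theta$ is a subset of $\Sigma$ containing $R,E$; a $\Theta$-formula uses only letters of $\Theta$; a $\Theta$-model $M$ has domain $D(M)$. $\Sigma_\varphi=\{R,E\}\cup\{\text{letters occurring in }\varphi\}$. $\varphi(x,\bar{w}_n)$ means free variables among $x,w_1,\dots,w_n$. An $n$-ary evaluation $\Theta$-point is $(M,a,\bar{b}_n)$ with $M$ a $\Theta$-model and $a,b_i\in D(M)$; $M,a,\bar{b}_n\models\varphi(x,\bar{w}_n)$ means $\varphi$ holds under any assignment $x\mapsto a,w_i\mapsto b_i$. Intuitionistic formulas: intuitionistic predicate formulas without identity. A fixed surjective map sends each $n$-ary intuitionistic letter $P$ to an $(n+1)$-ary letter $P'\in\Sigma\setminus\{R,E\}$. Standard $x$-translation: $ST(P(\bar{w}_n),x)=P'(x,\bar{w}_n)$; $ST(\bot,x)=(x\ne x)$; commutes with $\wedge,\vee$; $ST(i\to j,x)=\forall y(R(x,y)\to(ST(i,y)\to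 ST(j,y)))$; $ST(\exists w'i,x)=\exists w'(E(x,w')\wedge ST(i,x))$; $ST(\forall w'i,x)=\forall yw'((R(x,y)\wedge E(y,w'))\to ST(i,y))$. Classes: $K$ is a class of $\Theta$-models (for various vocabularies $\Theta$). $K(\Theta)$ is the class of $\Theta$-models in $K$; it is first-order axiomatizable iff there is a set $Ax$ of $\Theta$-sentences such that a $\Theta$-model is in $K$ iff it satisfies $Ax$. A set of formulas is $K$-satisfiable iff it is satisfied (under some assignment) in some model in $K$. $\varphi$ $K$-follows from $\Gamma$ ($\Gamma\models_K\varphi$) iff $\Gamma\cup\{\neg\varphi\}$ is not $K$-satisfiable; $\varphi$ and $\psi$ are $K$-equivalent iff $\varphi\models_K\psi$ and $\psi\models_K\varphi$. Asimulation: for $n$-ary evaluation $\Theta$-points $(M,a,\bar{b}_n),(N,c,\bar{d}_n)$, a relation $A$ whose elements are pairs $((a';\bar{b'}_l),(c';\bar{d'}_l))$ ($l\ge0$) with $a',\bar{b'}_l$ from $D(M)$ and $c',\bar{d'}_l$ from $D(N)$ or vice versa, is a $\langle(M,a,\bar{b}_n),(N,c,\bar{d}_n)\rangle$-asimulation iff $(a;\bar{b}_n)A(c;\bar{d}_n)$ and for all $\alpha,\beta\in\{M,N\}$, whenever $(a';\bar{b'}_l)A(c';\bar{d'}_l)$ with left side from $D(\alpha)$, right from $D(\beta)$: (1) for all $P\in\Theta\setminus\{R,E\}$, $\alpha,a',\bar{b'}_l\models P(x,\bar{w}_l)\Rightarrow\beta,c',\bar{d'}_l\models P(x,\bar{w}_l)$;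 (2) if $c'R^\beta c''$, there is $a''\in D(\alpha)$ with $a'R^\alpha a''$, $(c'';\bar{d'}_l)A(a'';\bar{b'}_l)$ and $(a'';\bar{b'}_l)A(c'';\bar{d'}_l)$; (3) if $E^\alpha(a',b'')$, there is $d''\in D(\beta)$ with $E^\beta(c',d'')$ and $(a';\bar{b'}_l,b'')A(c';\bar{d'}_l,d'')$; (4) if $c'R^\beta c''$ and $E^\beta(c'',d'')$, there are $a'',b''\in D(\alpha)$ with $a'R^\alpha a''$, $E^\alpha(a'',b'')$ and $(a'';\bar{b'}_l,b'')A(c'';\bar{d'}_l,d'')$. $\varphi(x,\bar{w}_n)$ is $K$-invariant with respect to asimulations iff for every vocabulary $\Theta\supseteq\Sigma_\varphi$ and all $n$-ary evaluation $\Theta$-points $(M,a,\bar{b}_n),(N,c,\bar{d}_n)$ with $M,N\in K$: if a $\langle(M,a,\bar{b}_n),(N,c,\bar{d}_n)\rangle$-asimulation exists and $M,a,\bar{b}_n\models\varphi$, then $N,c,\bar{d}_n\models\varphi$.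
   Formalization: Models in K have domains in one fixed infinite universe (the general case follows by Löwenheim–Skolem); a set of formulas is K-satisfiable iff satisfied in a model in K whose vocabulary is exactly that of the set, since the claim fails for some K not closed under reducts. *)

theory Defs
  imports Main
begin

section \<open>First-order syntax\<close>

text \<open>
  \<open>LP n m\<close> stands for $P^{n+1}_{m+1}$, so that every value of this type is a letter and
  the type itself is the vocabulary $\Sigma$.
\<close>

datatype letter = LR | LE | LP nat nat

fun arity :: "letter \<Rightarrow> nat" where
  "arity LR = 2"
| "arity LE = 2"
| "arity (LP n m) = Suc n"

definition vocabulary :: "letter set \<Rightarrow> bool" where
  "vocabulary \<Theta> \<longleftrightarrow> LR \<in> \<Theta> \<and> LE \<in> \<Theta>"

text \<open>
  \<open>X 0\<close> is the variable $x$, the other \<open>X k\<close> serve as the variables $y$ of the standard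
  translation, and \<open>W i\<close> is $w_{i+1}$.
\<close>

datatype var = X nat | W nat

datatype fm =
    Eq var var
  | Atom letter "var list"
  | Neg fm
  | Conj fm fm
  | Disj fm fm
  | Imp fm fm
  | Ex var fm
  | All var fm

primrec wf_fm :: "fm \<Rightarrow> bool" where
  "wf_fm (Eq u v) = True"
| "wf_fm (Atom l vs) = (length vs = arity l)"
| "wf_fm (Neg f) = wf_fm f"
| "wf_fm (Conj f g) = (wf_fm f \<and> wf_fm g)"
| "wf_fm (Disj f g) = (wf_fm f \<and> wf_fm g)"
| "wf_fm (Imp f g) = (wf_fm f \<and> wf_fm g)"
| "wf_fm (Ex v f) = wf_fm f"
| "wf_fm (All v f) = wf_fm f"

primrec fv :: "fm \<Rightarrow> var set" where
  "fv (Eq u v) = {u, v}"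
| "fv (Atom l vs) = set vs"
| "fv (Neg f) = fv f"
| "fv (Conj f g) = fv f \<union> fv g"
| "fv (Disj f g) = fv f \<union> fv g"
| "fv (Imp f g) = fv f \<union> fv g"
| "fv (Ex v f) = fv f - {v}"
| "fv (All v f) = fv f - {v}"

primrec letters :: "fm \<Rightarrow> letter set" where
  "letters (Eq u v) = {}"
| "letters (Atom l vs) = {l}"
| "letters (Neg f) = letters f"
| "letters (Conj f g) = letters f \<union> letters g"
| "letters (Disj f g) = letters f \<union> letters g"
| "letters (Imp f g) = letters f \<union> letters g"
| "letters (Ex v f) = letters f"
| "letters (All v f) = letters f"

definition Sigma_of :: "fm set \<Rightarrow> letter set" where
  "Sigma_of \<Gamma> = {LR, LE} \<union> (\<Union>f\<in>\<Gamma>. letters f)"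

section \<open>Models\<close>

text \<open>
  All domains are subsets of one universe type. As $\Sigma$ is countable, any infinite universe
  contains, up to isomorphism, an elementary submodel of every model. A model carries its vocabulary; requiring
  empty interpretations outside of it makes the representation of a model unique, so that a
  set of models cannot depend on irrelevant values.
\<close>

record 'u model =
  voc :: "letter set"
  Dom :: "'u set"
  interp :: "letter \<Rightarrow> 'u list set"

definition is_model :: "'u model \<Rightarrow> bool" where
  "is_model M \<longleftrightarrow> vocabulary (voc M) \<and> Dom M \<noteq> {} \<and>
     (\<forall>l\<in>voc M. \<forall>as\<in>interp M l. length as = arity l \<and> set as \<subseteq> Dom M) \<and>
     (\<forall>l. l \<notin> voc M \<longrightarrow> interp M l = {})"

primrec sat :: "'u model \<Rightarrow> (var \<Rightarrow> 'u) \<Rightarrow> fm \<Rightarrow> bool" where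
  "sat M s (Eq u v) = (s u = s v)"
| "sat M s (Atom l vs) = (map s vs \<in> interp M l)"
| "sat M s (Neg f) = (\<not> sat M s f)"
| "sat M s (Conj f g) = (sat M s f \<and> sat M s g)"
| "sat M s (Disj f g) = (sat M s f \<or> sat M s g)"
| "sat M s (Imp f g) = (sat M s f \<longrightarrow> sat M s g)"
| "sat M s (Ex v f) = (\<exists>d\<in>Dom M. sat M (s(v := d)) f)"
| "sat M s (All v f) = (\<forall>d\<in>Dom M. sat M (s(v := d)) f)"

definition assignment :: "'u model \<Rightarrow> (var \<Rightarrow> 'u) \<Rightarrow> bool" where
  "assignment M s \<longleftrightarrow> range s \<subseteq> Dom M"

definition point :: "'u model \<Rightarrow> 'u \<Rightarrow> 'u list \<Rightarrow> bool" where
  "point M a bs \<longleftrightarrow> is_model M \<and> a \<in> Dom M \<and> set bs \<subseteq> Dom M"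

definition sat_at :: "'u model \<Rightarrow> 'u \<Rightarrow> 'u list \<Rightarrow> fm \<Rightarrow> bool" where
  "sat_at M a bs f \<longleftrightarrow>
     (\<forall>s. assignment M s \<and> s (X 0) = a \<and> (\<forall>i<length bs. s (W i) = bs ! i) \<longrightarrow> sat M s f)"

section \<open>Classes of models\<close>

definition axiomatizable :: "'u model set \<Rightarrow> letter set \<Rightarrow> bool" where
  "axiomatizable K \<Theta> \<longleftrightarrow>
     (\<exists>Ax. (\<forall>f\<in>Ax. wf_fm f \<and> fv f = {} \<and> letters f \<subseteq> \<Theta>) \<and>
        (\<forall>M. is_model M \<and> voc M = \<Theta> \<longrightarrow>
           (M \<in> K \<longleftrightarrow> (\<forall>f\<in>Ax. \<forall>s. assignment M s \<longrightarrow> sat M s f))))"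

text \<open>
  A set of formulas is evaluated in the models for exactly its own vocabulary. For a class
  that is closed under reducts, this is the same as evaluating it in all models whose
  vocabulary contains that of the set; see \<open>K_satisfiable_iff_superset\<close> below.
\<close>

definition K_satisfiable :: "'u model set \<Rightarrow> fm set \<Rightarrow> bool" where
  "K_satisfiable K \<Gamma> \<longleftrightarrow>
     (\<exists>M\<in>K. voc M = Sigma_of \<Gamma> \<and> (\<exists>s. assignment M s \<and> (\<forall>f\<in>\<Gamma>. sat M s f)))"

definition K_follows :: "'u model set \<Rightarrow> fm set \<Rightarrow> fm \<Rightarrow> bool" where
  "K_follows K \<Gamma> f \<longleftrightarrow> \<not> K_satisfiable K (\<Gamma> \<union> {Neg f})"

definition K_equivalent :: "'u model set \<Rightarrow> fm \<Rightarrow> fm \<Rightarrow> bool" where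
  "K_equivalent K f g \<longleftrightarrow> K_follows K {f} g \<and> K_follows K {g} f"

definition reduct :: "'u model \<Rightarrow> letter set \<Rightarrow> 'u model" where
  "reduct M \<Theta> = \<lparr>voc = \<Theta>, Dom = Dom M, interp = (\<lambda>l. if l \<in> \<Theta> then interp M l else {})\<rparr>"

lemma sat_reduct: "letters f \<subseteq> \<Theta> \<Longrightarrow> sat (reduct M \<Theta>) s f = sat M s f"
  by (induction f arbitrary: s) (auto simp: reduct_def)

lemma K_satisfiable_iff_superset:
  assumes "\<And>M \<Theta>. M \<in> K \<Longrightarrow> vocabulary \<Theta> \<Longrightarrow> \<Theta> \<subseteq> voc M \<Longrightarrow> reduct M \<Theta> \<in> K"
  shows "K_satisfiable K \<Gamma> \<longleftrightarrow>
     (\<exists>M\<in>K. Sigma_of \<Gamma> \<subseteq> voc M \<and> (\<exists>s. assignment M s \<and> (\<forall>f\<in>\<Gamma>. sat M s f)))"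
proof
  assume "\<exists>M\<in>K. Sigma_of \<Gamma> \<subseteq> voc M \<and> (\<exists>s. assignment M s \<and> (\<forall>f\<in>\<Gamma>. sat M s f))"
  then obtain M s where M: "M \<in> K" "Sigma_of \<Gamma> \<subseteq> voc M"
    and s: "assignment M s" "\<forall>f\<in>\<Gamma>. sat M s f" by blast
  let ?N = "reduct M (Sigma_of \<Gamma>)"
  have "vocabulary (Sigma_of \<Gamma>)" by (simp add: vocabulary_def Sigma_of_def)
  with M have "?N \<in> K" using assms by blast
  moreover have "voc ?N = Sigma_of \<Gamma>" "assignment ?N s"
    using s(1) by (auto simp: reduct_def assignment_def)
  moreover have "\<forall>f\<in>\<Gamma>. sat ?N s f"
  proof
    fix f assume "f \<in> \<Gamma>"
    moreover from this have "letters f \<subseteq> Sigma_of \<Gamma>" by (auto simp: Sigma_of_def)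
    ultimately show "sat ?N s f" using s(2) by (simp add: sat_reduct)
  qed
  ultimately show "K_satisfiable K \<Gamma>" unfolding K_satisfiable_def by blast
qed (auto simp: K_satisfiable_def)

section \<open>Asimulations\<close>

text \<open>
  In condition (1), \<open>Q(x, w1, ..., wl)\<close> is read as an atom with first argument \<open>x\<close> whose
  remaining arguments are any of the variables \<open>w1, ..., wl\<close>, in any order and possibly with
  repetitions and omissions; these are the translations of the intuitionistic atoms whose
  variables are among \<open>w1, ..., wl\<close>.
\<close>

definition asimulation ::
  "'u model \<Rightarrow> 'u \<Rightarrow> 'u list \<Rightarrow> 'u model \<Rightarrow> 'u \<Rightarrow> 'u list \<Rightarrow>
   (('u \<times> 'u list) \<times> ('u \<times> 'u list)) set \<Rightarrow> bool" where
  "asimulation M a bs N c ds A \<longleftrightarrow>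
    (\<forall>a' bs' c' ds'. ((a', bs'), (c', ds')) \<in> A \<longrightarrow>
       length bs' = length ds' \<and>
       (insert a' (set bs') \<subseteq> Dom M \<and> insert c' (set ds') \<subseteq> Dom N \<or>
        insert a' (set bs') \<subseteq> Dom N \<and> insert c' (set ds') \<subseteq> Dom M)) \<and>
    ((a, bs), (c, ds)) \<in> A \<and>
    (\<forall>\<alpha>\<in>{M, N}. \<forall>\<beta>\<in>{M, N}. \<forall>a' bs' c' ds'.
       ((a', bs'), (c', ds')) \<in> A \<and>
       insert a' (set bs') \<subseteq> Dom \<alpha> \<and> insert c' (set ds') \<subseteq> Dom \<beta> \<longrightarrow>
       (\<forall>Q\<in>voc M - {LR, LE}. \<forall>js. Suc (length js) = arity Q \<and> set js \<subseteq> {..<length bs'} \<longrightarrow>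
          sat_at \<alpha> a' bs' (Atom Q (X 0 # map W js)) \<longrightarrow>
          sat_at \<beta> c' ds' (Atom Q (X 0 # map W js))) \<and>
       (\<forall>c''. [c', c''] \<in> interp \<beta> LR \<longrightarrow>
          (\<exists>a''\<in>Dom \<alpha>. [a', a''] \<in> interp \<alpha> LR \<and>
             ((c'', ds'), (a'', bs')) \<in> A \<and> ((a'', bs'), (c'', ds')) \<in> A)) \<and>
       (\<forall>b''. [a', b''] \<in> interp \<alpha> LE \<longrightarrow>
          (\<exists>d''\<in>Dom \<beta>. [c', d''] \<in> interp \<beta> LE \<and>
             ((a', bs' @ [b'']), (c', ds' @ [d''])) \<in> A)) \<and>
       (\<forall>c'' d''. [c', c''] \<in> interp \<beta> LR \<and> [c'', d''] \<in> interp \<beta> LE \<longrightarrow>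
          (\<exists>a''\<in>Dom \<alpha>. \<exists>b''\<in>Dom \<alpha>. [a', a''] \<in> interp \<alpha> LR \<and> [a'', b''] \<in> interp \<alpha> LE \<and>
             ((a'', bs' @ [b'']), (c'', ds' @ [d''])) \<in> A)))"

definition K_invariant :: "'u model set \<Rightarrow> nat \<Rightarrow> fm \<Rightarrow> bool" where
  "K_invariant K n f \<longleftrightarrow>
    (\<forall>\<Theta> M a bs N c ds. vocabulary \<Theta> \<and> Sigma_of {f} \<subseteq> \<Theta> \<and>
       M \<in> K \<and> N \<in> K \<and> voc M = \<Theta> \<and> voc N = \<Theta> \<and>
       point M a bs \<and> point N c ds \<and> length bs = n \<and> length ds = n \<and>
       (\<exists>A. asimulation M a bs N c ds A) \<and> sat_at M a bs f \<longrightarrow> sat_at N c ds f)"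

section \<open>Intuitionistic formulas and their standard translation\<close>

text \<open>Variables are given by their indices, \<open>i\<close> standing for \<open>W i\<close>.\<close>

datatype 'p ifm =
    IAtom 'p "nat list"
  | IBot
  | IConj "'p ifm" "'p ifm"
  | IDisj "'p ifm" "'p ifm"
  | IImp "'p ifm" "'p ifm"
  | IEx nat "'p ifm"
  | IAll nat "'p ifm"

primrec wf_ifm :: "('p \<Rightarrow> nat) \<Rightarrow> 'p ifm \<Rightarrow> bool" where
  "wf_ifm ar (IAtom p vs) = (length vs = ar p)"
| "wf_ifm ar IBot = True"
| "wf_ifm ar (IConj i j) = (wf_ifm ar i \<and> wf_ifm ar j)"
| "wf_ifm ar (IDisj i j) = (wf_ifm ar i \<and> wf_ifm ar j)"
| "wf_ifm ar (IImp i j) = (wf_ifm ar i \<and> wf_ifm ar j)"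
| "wf_ifm ar (IEx w i) = wf_ifm ar i"
| "wf_ifm ar (IAll w i) = wf_ifm ar i"

primrec ifv :: "'p ifm \<Rightarrow> nat set" where
  "ifv (IAtom p vs) = set vs"
| "ifv IBot = {}"
| "ifv (IConj i j) = ifv i \<union> ifv j"
| "ifv (IDisj i j) = ifv i \<union> ifv j"
| "ifv (IImp i j) = ifv i \<union> ifv j"
| "ifv (IEx w i) = ifv i - {w}"
| "ifv (IAll w i) = ifv i - {w}"

definition letter_map :: "('p \<Rightarrow> nat) \<Rightarrow> ('p \<Rightarrow> letter) \<Rightarrow> bool" where
  "letter_map ar pr \<longleftrightarrow> (\<forall>p. arity (pr p) = Suc (ar p)) \<and> range pr = UNIV - {LR, LE}"

text \<open>\<open>ST pr i k\<close> is the translation at the variable \<open>X k\<close>, with \<open>X (Suc k)\<close> in the role of $y$.\<close>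

primrec ST :: "('p \<Rightarrow> letter) \<Rightarrow> 'p ifm \<Rightarrow> nat \<Rightarrow> fm" where
  "ST pr (IAtom p vs) k = Atom (pr p) (X k # map W vs)"
| "ST pr IBot k = Neg (Eq (X k) (X k))"
| "ST pr (IConj i j) k = Conj (ST pr i k) (ST pr j k)"
| "ST pr (IDisj i j) k = Disj (ST pr i k) (ST pr j k)"
| "ST pr (IImp i j) k =
     All (X (Suc k)) (Imp (Atom LR [X k, X (Suc k)]) (Imp (ST pr i (Suc k)) (ST pr j (Suc k))))"
| "ST pr (IEx w i) k = Ex (W w) (Conj (Atom LE [X k, W w]) (ST pr i k))"
| "ST pr (IAll w i) k =
     All (X (Suc k)) (All (W w)
       (Imp (Conj (Atom LR [X k, X (Suc k)]) (Atom LE [X (Suc k), W w])) (ST pr i (Suc k))))"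

end

theory Submission
  imports Defs "HOL-Library.Countable_Set"
begin

text \<open>
  If no translation is \<open>K\<close>-equivalent to \<open>\<phi>\<close>, then for every finite set of intuitionistic formulas
  there are a point satisfying \<open>\<phi>\<close> and a point falsifying it such that truth of these formulas is
  preserved from the first to the second. Ultraproducts of such points over a free ultrafilter on the
  natural numbers preserve truth of all intuitionistic formulas and are countably saturated, so that
  inclusion of intuitionistic types is an asimulation between them. The ultraproducts need not fit
  into the given universe; but countable elementary submodels that are jointly closed under the
  witnesses of the asimulation conditions do, and they contradict the invariance of \<open>\<phi>\<close>.
\<close>

section \<open>Free ultrafilters on the natural numbers\<close>

text \<open>There are only countably many formulas, so a sequence of pairs of points, the k-th pair
  taking care of the formulas with code below k, covers every finite set, and an ultrafilter on the
  natural numbers suffices. Everything happens over the finite vocabulary of \<phi>, where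
  axiomatizability turns Los's theorem into membership in \<open>K\<close>. The obstacle is the
  passage to countable submodels. Types are always computed on the sequences, hence in the full
  ultraproducts, so they do not change; but the witnesses for the asimulation conditions must lie in
  the submodels. A witness on one side depends on parameters from both sides, so the two submodels
  cannot be chosen independently: one countable set of sequences is closed under Skolem witnesses
  and asimulation witnesses together. A second obstacle is that a pair in an asimulation does not
  remember which model its components come from, and the conditions are imposed for every possible
  reading. The two submodels are therefore copied onto disjoint subsets of the universe.\<close>

locale free_ultrafilter =
  fixes U :: "nat filter"
  assumes nontrivial: "U \<noteq> bot"
    and ultra: "eventually P U \<or> eventually (\<lambda>k. \<not> P k) U"
    and free: "U \<le> sequentially"
begin

lemma eventually_not: "eventually (\<lambda>k. \<not> P k) U \<longleftrightarrow> \<not> eventually P U"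
proof
  assume 1: "eventually (\<lambda>k. \<not> P k) U"
  show "\<not> eventually P U"
  proof
    assume "eventually P U"
    with 1 have "eventually (\<lambda>k. False) U" by eventually_elim simp
    with nontrivial show False by (simp add: eventually_False)
  qed
qed (use ultra in blast)

lemma eventually_disj: "eventually (\<lambda>k. P k \<or> Q k) U \<longleftrightarrow> eventually P U \<or> eventually Q U"
proof -
  have "eventually (\<lambda>k. \<not> (\<not> P k \<and> \<not> Q k)) U \<longleftrightarrow> \<not> (\<not> eventually P U \<and> \<not> eventually Q U)"
    by (simp only: eventually_not eventually_conj_iff)
  then show ?thesis by (simp only: de_Morgan_conj not_not)
qed

lemma eventually_implies:
  "eventually (\<lambda>k. P k \<longrightarrow> Q k) U \<longleftrightarrow> (eventually P U \<longrightarrow> eventually Q U)"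
  using eventually_disj[of "\<lambda>k. \<not> P k" Q] by (simp add: eventually_not)

lemma eventually_gt: "eventually (\<lambda>k. m < k) U"
  using free eventually_gt_at_top[of m] by (rule filter_leD)

text \<open>At coordinate \<open>k\<close>, choose an element meeting as long an initial segment of
  the conditions as possible. A fixed finite segment is satisfiable at almost all coordinates, so
  the chosen elements meet each single condition almost everywhere.\<close>

lemma countably_saturated:
  fixes P :: "'i::countable \<Rightarrow> nat \<Rightarrow> 'y \<Rightarrow> bool"
  assumes nonempty: "\<And>k. D k \<noteq> {}"
    and finitely: "\<And>I. finite I \<Longrightarrow> eventually (\<lambda>k. \<exists>y\<in>D k. \<forall>i\<in>I. P i k y) U"
  obtains g where "\<And>k. g k \<in> D k" "\<And>i. eventually (\<lambda>k. P i k (g k)) U"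
proof -
  define ok where "ok m k \<longleftrightarrow> (\<exists>y\<in>D k. \<forall>i. to_nat i < m \<longrightarrow> P i k y)" for m k
  \<comment> \<open>The bound \<open>m \<le> k\<close> makes the greatest value exist. It costs
    nothing: \<open>U\<close> is free, so \<open>k\<close> exceeds any fixed index almost
    everywhere.\<close>
  define top_ok where "top_ok k = (GREATEST m. m \<le> k \<and> ok m k)" for k
  have ok0: "ok 0 k" for k using nonempty[of k] by (auto simp: ok_def)
  have top_ok: "ok (top_ok k) k" for k
    using GreatestI_nat[of "\<lambda>m. m \<le> k \<and> ok m k" 0 k] ok0 by (simp add: top_ok_def)
  have le_top: "m \<le> top_ok k" if "m \<le> k" "ok m k" for m k
    using Greatest_le_nat[of "\<lambda>m. m \<le> k \<and> ok m k" m k] that by (simp add: top_ok_def)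
  obtain g where g: "g k \<in> D k" "\<And>i. to_nat i < top_ok k \<Longrightarrow> P i k (g k)" for k
    using top_ok unfolding ok_def by metis
  have "eventually (\<lambda>k. P i k (g k)) U" for i
  proof -
    have "finite {j::'i. to_nat j < Suc (to_nat i)}"
      using finite_vimageI[OF finite_lessThan inj_to_nat] by (simp add: vimage_def lessThan_def)
    from finitely[OF this] have "eventually (ok (Suc (to_nat i))) U"
      by (simp add: ok_def[abs_def])
    with eventually_gt[of "to_nat i"] show ?thesis
    proof eventually_elim
      case (elim k)
      then show ?case using g(2)[of i k] le_top[of "Suc (to_nat i)" k] by simp
    qed
  qed
  with g(1) show ?thesis by (rule that)
qed

end

text \<open>A smaller filter has more eventual properties, so Zorn's lemma is applied downwards. The
  infimum of a nonempty chain is proper because whatever holds eventually in it already does so in a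
  member.\<close>

lemma ex_free_ultrafilter: "\<exists>U. free_ultrafilter U"
proof -
  let ?A = "{F :: nat filter. F \<noteq> bot \<and> F \<le> sequentially}"
  have "\<exists>U\<in>?A. \<forall>F\<in>?A. F \<le> U \<longrightarrow> F = U"
  proof (rule predicate_Zorn[of ?A "\<lambda>F G. G \<le> F"])
    show "partial_order_on ?A (relation_of (\<lambda>F G. G \<le> F) ?A)"
      by (rule partial_order_on_relation_ofI) auto
    show "\<exists>u\<in>?A. \<forall>F\<in>C. u \<le> F" if C: "C \<in> Chains (relation_of (\<lambda>F G. G \<le> F) ?A)" for C
    proof (cases "C = {}")
      case True
      then show ?thesis by (auto intro!: exI[of _ sequentially])
    next
      case False
      have sub: "C \<subseteq> ?A" and chain: "F \<le> G \<or> G \<le> F" if "F \<in> C" "G \<in> C" for F G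
        using C that by (auto simp: Chains_def relation_of_def)
      have "Inf C \<noteq> bot"
      proof
        assume "Inf C = bot"
        then have "eventually (\<lambda>_. False) (Inf C)" by simp
        then obtain F where "F \<in> C" "eventually (\<lambda>_. False) F"
          by (subst (asm) eventually_Inf_base[OF False]) (use chain in \<open>metis inf.absorb1 inf.absorb2 order_refl\<close>)+
        with sub show False by (auto simp: eventually_False)
      qed
      moreover have "Inf C \<le> sequentially"
      proof -
        obtain F where "F \<in> C" using False by blast
        then show ?thesis using sub by (intro Inf_lower2[of F]) auto
      qed
      ultimately show ?thesis by (auto intro: Inf_lower)
    qed
  qed
  then obtain U where U: "U \<noteq> bot" "U \<le> sequentially"
    and min: "\<And>F. F \<noteq> bot \<Longrightarrow> F \<le> sequentially \<Longrightarrow> F \<le> U \<Longrightarrow> F = U" by auto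
  have "eventually P U \<or> eventually (\<lambda>k. \<not> P k) U" for P
  proof (rule disjCI)
    assume "\<not> eventually (\<lambda>k. \<not> P k) U"
    \<comment> \<open>Forcing \<open>P\<close> into \<open>U\<close> keeps the filter proper, since
      the negation of \<open>P\<close> is not eventual; minimality then yields \<open>U\<close>
      itself.\<close>
    let ?F = "inf U (principal {k. P k})"
    have "?F \<noteq> bot"
    proof
      assume "?F = bot"
      then have "eventually (\<lambda>_. False) ?F" by simp
      then show False using \<open>\<not> eventually (\<lambda>k. \<not> P k) U\<close> by (simp add: eventually_inf_principal)
    qed
    then have "?F = U" using min[of ?F] U(2) by (simp add: le_infI1)
    moreover have "eventually P ?F" by (simp add: eventually_inf_principal)
    ultimately show "eventually P U" by simp
  qed
  with U show ?thesis by (auto simp: free_ultrafilter_def)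
qed

section \<open>Countable closures\<close>

text \<open>The downward Loewenheim-Skolem construction for arbitrary requests: each stage adds one
  chosen answer per request and parameter list. Answers are lists, so several elements can be
  requested at once; for an unsolvable request, \<open>SOME\<close> adds a harmless finite
  set.\<close>

lemma countable_witness_closure:
  fixes \<P> :: "('a list \<Rightarrow> 'a list \<Rightarrow> bool) set"
  assumes "countable \<P>" "countable S"
  obtains C where "countable C" "S \<subseteq> C"
    "\<And>P xs ys. P \<in> \<P> \<Longrightarrow> set xs \<subseteq> C \<Longrightarrow> P xs ys \<Longrightarrow> \<exists>zs. set zs \<subseteq> C \<and> P xs zs"
proof -
  define F where "F X = X \<union> (\<Union>(P, xs)\<in>\<P> \<times> lists X. set (SOME zs. P xs zs))" for X
  define C where "C = (\<Union>n. (F ^^ n) S)"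
  have "countable ((F ^^ n) S)" for n
  proof (induction n)
    case (Suc n)
    have "countable (F X)" if "countable X" for X
      unfolding F_def using assms(1) that
      by (intro countable_Un countable_UN countable_SIGMA countable_lists)
        (auto simp: countable_finite split: prod.split)
    with Suc show ?case by simp
  qed (use assms in simp)
  then have "countable C" by (simp add: C_def)
  moreover have "S \<subseteq> C" unfolding C_def by (metis UNIV_I UN_upper funpow_0)
  moreover have "\<exists>zs. set zs \<subseteq> C \<and> P xs zs" if P: "P \<in> \<P>" and xs: "set xs \<subseteq> C" and ys: "P xs ys" for P xs ys
  proof -
    have mono: "(F ^^ m) S \<subseteq> (F ^^ n) S" if "m \<le> n" for m n
      by (rule lift_Suc_mono_le[OF _ that]) (simp add: F_def)
    \<comment> \<open>A list has finitely many entries and the stages increase, so all its entries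
      are present at a common stage.\<close>
    have "\<exists>n. set xs \<subseteq> (F ^^ n) S" using xs
    proof (induction xs)
      case (Cons x xs)
      then obtain m n where "x \<in> (F ^^ m) S" "set xs \<subseteq> (F ^^ n) S" by (auto simp: C_def)
      then show ?case using mono[of m "max m n"] mono[of n "max m n"]
        by (intro exI[of _ "max m n"]) auto
    qed simp
    then obtain n where n: "set xs \<subseteq> (F ^^ n) S" by blast
    have "set (SOME zs. P xs zs) \<subseteq> F ((F ^^ n) S)"
      using P n by (auto simp: F_def in_lists_conv_set)
    also have "\<dots> = (F ^^ Suc n) S" by simp
    also have "\<dots> \<subseteq> C" unfolding C_def by blast
    finally show ?thesis using someI[of "P xs", OF ys] by blast
  qed
  ultimately show ?thesis by (rule that)
qed

text \<open>Countability of \<open>ifm\<close> makes saturation over an index set of formulas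
  available; countability of \<open>fm\<close> and \<open>var\<close> bounds the number of Skolem
  requests.\<close>

instance letter :: countable by countable_datatype
instance var :: countable by countable_datatype
instance fm :: countable by countable_datatype
instance ifm :: (countable) countable by countable_datatype

section \<open>Forcing\<close>

text \<open>Evaluates translations without the auxiliary variables \<open>X k\<close>. The letters
  of \<Sigma> themselves serve as intuitionistic letters. The models are arbitrary: neither a
  preorder nor persistence of atoms is assumed.\<close>

primrec force :: "'u model \<Rightarrow> letter ifm \<Rightarrow> 'u \<Rightarrow> (nat \<Rightarrow> 'u) \<Rightarrow> bool" where
  "force M (IAtom l vs) a e = (a # map e vs \<in> interp M l)"
| "force M IBot a e = False"
| "force M (IConj i j) a e = (force M i a e \<and> force M j a e)"
| "force M (IDisj i j) a e = (force M i a e \<or> force M j a e)"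
| "force M (IImp i j) a e =
     (\<forall>y\<in>Dom M. [a, y] \<in> interp M LR \<longrightarrow> force M i y e \<longrightarrow> force M j y e)"
| "force M (IEx w i) a e = (\<exists>d\<in>Dom M. [a, d] \<in> interp M LE \<and> force M i a (e(w := d)))"
| "force M (IAll w i) a e =
     (\<forall>y\<in>Dom M. \<forall>d\<in>Dom M. [a, y] \<in> interp M LR \<longrightarrow> [y, d] \<in> interp M LE \<longrightarrow>
        force M i y (e(w := d)))"

lemma sat_ST: "sat M s (ST (\<lambda>l. l) i k) \<longleftrightarrow> force M i (s (X k)) (\<lambda>j. s (W j))"
proof (induction i arbitrary: s k)
  case (IEx w i)
  have "(\<lambda>j. (s(W w := d)) (W j)) = (\<lambda>j. s (W j))(w := d)" for d by auto
  then show ?case by (simp add: IEx)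
next
  case (IAll w i)
  have "(\<lambda>j. (s(X (Suc k) := y, W w := d)) (W j)) = (\<lambda>j. s (W j))(w := d)" for y d by auto
  then show ?case by (auto simp: IAll)
qed (simp_all add: comp_def)

lemma force_cong: "(\<And>j. j \<in> ifv i \<Longrightarrow> e j = e' j) \<Longrightarrow> force M i a e \<longleftrightarrow> force M i a e'"
proof (induction i arbitrary: a e e')
  case (IAtom l vs)
  then have "map e vs = map e' vs" by simp
  then show ?case by (simp only: force.simps)
next
  case (IConj i j)
  have "force M i a e = force M i a e'" by (rule IConj.IH(1)) (use IConj.prems in auto)
  moreover have "force M j a e = force M j a e'" by (rule IConj.IH(2)) (use IConj.prems in auto)
  ultimately show ?case by simp
next
  case (IDisj i j)
  have "force M i a e = force M i a e'" by (rule IDisj.IH(1)) (use IDisj.prems in auto)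
  moreover have "force M j a e = force M j a e'" by (rule IDisj.IH(2)) (use IDisj.prems in auto)
  ultimately show ?case by simp
next
  case (IImp i j)
  have "force M i y e = force M i y e'" for y by (rule IImp.IH(1)) (use IImp.prems in auto)
  moreover have "force M j y e = force M j y e'" for y by (rule IImp.IH(2)) (use IImp.prems in auto)
  ultimately show ?case by simp
next
  case (IEx w i)
  have "force M i a (e(w := d)) = force M i a (e'(w := d))" for d
    by (rule IEx.IH) (use IEx.prems in auto)
  then show ?case by simp
next
  case (IAll w i)
  have "force M i y (e(w := d)) = force M i y (e'(w := d))" for d y
    by (rule IAll.IH) (use IAll.prems in auto)
  then show ?case by simp
qed simp

text \<open>The arity drops by one because the first argument of a translated atom is the
  world.\<close>

definition Form :: "letter set \<Rightarrow> nat \<Rightarrow> letter ifm set" where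
  "Form \<Theta> n = {i. wf_ifm (\<lambda>l. arity l - 1) i \<and> ifv i \<subseteq> {..<n} \<and> set_ifm i \<subseteq> \<Theta> - {LR, LE}}"

lemma force_cong_Form:
  "i \<in> Form \<Theta> n \<Longrightarrow> (\<And>j. j < n \<Longrightarrow> e j = e' j) \<Longrightarrow> force M i a e \<longleftrightarrow> force M i a e'"
  by (rule force_cong) (auto simp: Form_def)

lemma Form_IImp: "i \<in> Form \<Theta> n \<Longrightarrow> j \<in> Form \<Theta> n \<Longrightarrow> IImp i j \<in> Form \<Theta> n"
  by (auto simp: Form_def)

text \<open>Variable \<open>n\<close> names the element appended to a tuple of length
  \<open>n\<close>; binding it leads back to the shorter tuple.\<close>

lemma Form_IEx: "i \<in> Form \<Theta> (Suc n) \<Longrightarrow> IEx n i \<in> Form \<Theta> n"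
  and Form_IAll: "i \<in> Form \<Theta> (Suc n) \<Longrightarrow> IAll n i \<in> Form \<Theta> n"
  by (auto simp: Form_def less_Suc_eq)

lemma finite_conjunction:
  assumes "finite I" "I \<subseteq> Form \<Theta> n"
  obtains \<chi> where "\<chi> \<in> Form \<Theta> n"
    "\<And>(M :: 'u model) a e. force M \<chi> a e \<longleftrightarrow> (\<forall>i\<in>I. force M i a e)"
proof -
  have "\<exists>\<chi>\<in>Form \<Theta> n. \<forall>(M :: 'u model) a e. force M \<chi> a e \<longleftrightarrow> (\<forall>i\<in>I. force M i a e)"
    using assms
  proof (induction I rule: finite_induct)
    case empty
    \<comment> \<open>The empty conjunction needs a formula forced everywhere, and the syntax has no
      constant for truth.\<close>
    then show ?case by (intro bexI[of _ "IImp IBot IBot"]) (auto simp: Form_def)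
  next
    case (insert i I)
    then obtain \<chi> where "\<chi> \<in> Form \<Theta> n"
      "\<forall>(M :: 'u model) a e. force M \<chi> a e \<longleftrightarrow> (\<forall>i\<in>I. force M i a e)" by auto
    with insert.prems show ?case
      by (intro bexI[of _ "IConj i \<chi>"]) (auto simp: Form_def)
  qed
  with that show ?thesis by blast
qed

lemma finite_disjunction:
  assumes "finite I" "I \<subseteq> Form \<Theta> n"
  obtains \<chi> where "\<chi> \<in> Form \<Theta> n"
    "\<And>(M :: 'u model) a e. force M \<chi> a e \<longleftrightarrow> (\<exists>i\<in>I. force M i a e)"
proof -
  have "\<exists>\<chi>\<in>Form \<Theta> n. \<forall>(M :: 'u model) a e. force M \<chi> a e \<longleftrightarrow> (\<exists>i\<in>I. force M i a e)"
    using assms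
  proof (induction I rule: finite_induct)
    case empty
    then show ?case by (intro bexI[of _ IBot]) (auto simp: Form_def)
  next
    case (insert i I)
    then obtain \<chi> where "\<chi> \<in> Form \<Theta> n"
      "\<forall>(M :: 'u model) a e. force M \<chi> a e \<longleftrightarrow> (\<exists>i\<in>I. force M i a e)" by auto
    with insert.prems show ?case
      by (intro bexI[of _ "IDisj i \<chi>"]) (auto simp: Form_def)
  qed
  with that show ?thesis by blast
qed

section \<open>Types in sequences of models\<close>

text \<open>Elements of the ultraproduct are handled through representing sequences. No quotient is
  formed; sequences equal almost everywhere are identified only when a submodel is copied into the
  universe.\<close>

definition seqs :: "(nat \<Rightarrow> 'u model) \<Rightarrow> (nat \<Rightarrow> 'u) set" where
  "seqs Ms = {g. \<forall>k. g k \<in> Dom (Ms k)}"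

context free_ultrafilter
begin

definition hold :: "(nat \<Rightarrow> 'u model) \<Rightarrow> letter \<Rightarrow> (nat \<Rightarrow> 'u) list \<Rightarrow> bool" where
  "hold Ms l fs \<longleftrightarrow> eventually (\<lambda>k. map (\<lambda>f. f k) fs \<in> interp (Ms k) l) U"

text \<open>Beyond the end of \<open>bs\<close> the evaluation is unspecified; this is harmless for
  formulas in \<open>Form \<Theta> (length bs)\<close>.\<close>

definition uforce :: "(nat \<Rightarrow> 'u model) \<Rightarrow> letter ifm \<Rightarrow> (nat \<Rightarrow> 'u) \<Rightarrow> (nat \<Rightarrow> 'u) list \<Rightarrow> bool" where
  "uforce Ms i a bs \<longleftrightarrow> eventually (\<lambda>k. force (Ms k) i (a k) (\<lambda>j. (bs ! j) k)) U"

definition tp :: "letter set \<Rightarrow> (nat \<Rightarrow> 'u model) \<Rightarrow> (nat \<Rightarrow> 'u) \<Rightarrow> (nat \<Rightarrow> 'u) list \<Rightarrow> letter ifm set" where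
  "tp \<Theta> Ms a bs = {i \<in> Form \<Theta> (length bs). uforce Ms i a bs}"

lemma tpI: "i \<in> Form \<Theta> (length bs) \<Longrightarrow> uforce Ms i a bs \<Longrightarrow> i \<in> tp \<Theta> Ms a bs"
  by (simp add: tp_def)

lemma force_append:
  assumes "i \<in> Form \<Theta> (Suc (length bs))"
  shows "force M i a (\<lambda>j. ((bs @ [b]) ! j) k) \<longleftrightarrow> force M i a ((\<lambda>j. (bs ! j) k)(length bs := b k))"
  by (rule force_cong_Form[OF assms]) (auto simp: nth_append less_Suc_eq)

text \<open>
  In each of the three steps a finite part of the type to be realized is expressed by one formula
  (an implication, an existential and a universal one, respectively), whose truth value is
  transferred by the assumed inclusion of types.
\<close>

lemma step_implication:
  fixes Ms Ns :: "nat \<Rightarrow> 'u model"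
  assumes ne: "\<And>k. Dom (Ms k) \<noteq> {}" and c': "c' \<in> seqs Ns"
    and len: "length bs = length ds" and sub: "tp \<Theta> Ms a bs \<subseteq> tp \<Theta> Ns c ds"
    and R: "hold Ns LR [c, c']"
  shows "\<exists>a'\<in>seqs Ms. hold Ms LR [a, a'] \<and> tp \<Theta> Ms a' bs = tp \<Theta> Ns c' ds"
proof -
  define T where "T = tp \<Theta> Ns c' ds"
  \<comment> \<open>Condition (2) of an asimulation asks for the pair in both orders, hence for
    equal types: formulas outside \<open>T\<close> must be refuted as well as those in
    \<open>T\<close> forced.\<close>
  define P where "P i k y \<longleftrightarrow> [a k, y] \<in> interp (Ms k) LR \<and>
    (i \<in> Form \<Theta> (length bs) \<longrightarrow> (force (Ms k) i y (\<lambda>j. (bs ! j) k) \<longleftrightarrow> i \<in> T))" for i k y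
  have "eventually (\<lambda>k. \<exists>y\<in>Dom (Ms k). \<forall>i\<in>I. P i k y) U" if "finite I" for I
  proof -
    have fin: "finite (I \<inter> T)" "finite (I \<inter> Form \<Theta> (length bs) - T)" using that by auto
    have "T \<subseteq> Form \<Theta> (length bs)" by (auto simp: T_def tp_def len)
    then have sub1: "I \<inter> T \<subseteq> Form \<Theta> (length bs)" by blast
    obtain p where p: "p \<in> Form \<Theta> (length bs)"
      "\<And>(M :: 'u model) a e. force M p a e \<longleftrightarrow> (\<forall>i\<in>I \<inter> T. force M i a e)"
      by (rule finite_conjunction[OF fin(1) sub1]) blast
    have sub2: "I \<inter> Form \<Theta> (length bs) - T \<subseteq> Form \<Theta> (length bs)" by blast
    obtain q where q: "q \<in> Form \<Theta> (length bs)"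
      "\<And>(M :: 'u model) a e. force M q a e \<longleftrightarrow> (\<exists>i\<in>I \<inter> Form \<Theta> (length bs) - T. force M i a e)"
      by (rule finite_disjunction[OF fin(2) sub2]) blast
    have "uforce Ns i c' ds" if "i \<in> T" for i using that by (simp add: T_def tp_def)
    then have 1: "eventually (\<lambda>k. force (Ns k) p (c' k) (\<lambda>j. (ds ! j) k)) U"
      unfolding p uforce_def by (intro eventually_ball_finite fin) auto
    have "\<not> uforce Ns i c' ds" if "i \<in> Form \<Theta> (length bs) - T" for i
      using that by (simp add: T_def tp_def len)
    then have "eventually (\<lambda>k. \<forall>i\<in>I \<inter> Form \<Theta> (length bs) - T. \<not> force (Ns k) i (c' k) (\<lambda>j. (ds ! j) k)) U"
      unfolding uforce_def by (intro eventually_ball_finite fin) (auto simp: eventually_not)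
    then have 2: "eventually (\<lambda>k. \<not> force (Ns k) q (c' k) (\<lambda>j. (ds ! j) k)) U"
      by (simp add: q)
    \<comment> \<open>Almost everywhere \<open>c'\<close> is a successor of \<open>c\<close> forcing
      \<open>p\<close> but not \<open>q\<close>. So the implication fails at \<open>c\<close>, by
      inclusion of types also at \<open>a\<close>, and a successor of \<open>a\<close> refuting it
      is the element sought.\<close>
    have "eventually (\<lambda>k. \<not> force (Ns k) (IImp p q) (c k) (\<lambda>j. (ds ! j) k)) U"
      using R[unfolded hold_def] 1 2
    proof eventually_elim
      case (elim k)
      then show ?case using c' by (auto simp: seqs_def)
    qed
    then have "IImp p q \<notin> tp \<Theta> Ns c ds"
      by (simp add: tp_def uforce_def eventually_not del: force.simps)
    with sub have "\<not> uforce Ms (IImp p q) a bs" using Form_IImp[OF p(1) q(1)] by (auto simp: tp_def)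
    then have "eventually (\<lambda>k. \<not> force (Ms k) (IImp p q) (a k) (\<lambda>j. (bs ! j) k)) U"
      by (simp add: uforce_def eventually_not del: force.simps)
    then show ?thesis
    proof eventually_elim
      case (elim k)
      then show ?case by (auto simp: P_def p q)
    qed
  qed
  from countably_saturated[where P = P, OF ne this] obtain a'
    where a': "\<And>k. a' k \<in> Dom (Ms k)" "\<And>i. eventually (\<lambda>k. P i k (a' k)) U" by blast
  \<comment> \<open>\<open>IBot\<close> is just some index: the first conjunct of \<open>P\<close>
    is the same for all.\<close>
  have "hold Ms LR [a, a']" using a'(2)[of IBot] by (auto simp: hold_def P_def elim: eventually_mono)
  moreover have "i \<in> tp \<Theta> Ms a' bs \<longleftrightarrow> i \<in> T" for i
  proof (cases "i \<in> Form \<Theta> (length bs)")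
    case True
    have "eventually (\<lambda>k. force (Ms k) i (a' k) (\<lambda>j. (bs ! j) k) \<longleftrightarrow> i \<in> T) U"
      using a'(2)[of i] by eventually_elim (simp add: P_def True)
    then have "uforce Ms i a' bs \<longleftrightarrow> i \<in> T"
      by (cases "i \<in> T") (simp_all add: uforce_def eventually_not)
    with True show ?thesis by (simp add: tp_def)
  qed (auto simp: T_def tp_def len)
  ultimately show ?thesis using a'(1) by (auto simp: seqs_def T_def)
qed

lemma step_existential:
  fixes Ms Ns :: "nat \<Rightarrow> 'u model"
  assumes ne: "\<And>k. Dom (Ns k) \<noteq> {}" and b: "b \<in> seqs Ms"
    and len: "length bs = length ds" and sub: "tp \<Theta> Ms a bs \<subseteq> tp \<Theta> Ns c ds"
    and E: "hold Ms LE [a, b]"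
  shows "\<exists>d\<in>seqs Ns. hold Ns LE [c, d] \<and> tp \<Theta> Ms a (bs @ [b]) \<subseteq> tp \<Theta> Ns c (ds @ [d])"
proof -
  define T where "T = tp \<Theta> Ms a (bs @ [b])"
  have T: "T \<subseteq> Form \<Theta> (Suc (length bs))" by (auto simp: T_def tp_def)
  \<comment> \<open>Only inclusion is wanted here, so it is enough to realize the positive part of
    the type.\<close>
  define P where "P i k y \<longleftrightarrow> [c k, y] \<in> interp (Ns k) LE \<and>
    (i \<in> T \<longrightarrow> force (Ns k) i (c k) ((\<lambda>j. (ds ! j) k)(length ds := y)))" for i k y
  have "eventually (\<lambda>k. \<exists>y\<in>Dom (Ns k). \<forall>i\<in>I. P i k y) U" if "finite I" for I
  proof -
    have fin: "finite (I \<inter> T)" and sub1: "I \<inter> T \<subseteq> Form \<Theta> (Suc (length bs))" using that T by auto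
    obtain p where p: "p \<in> Form \<Theta> (Suc (length bs))"
      "\<And>(M :: 'u model) a e. force M p a e \<longleftrightarrow> (\<forall>i\<in>I \<inter> T. force M i a e)"
      by (rule finite_conjunction[OF fin sub1]) blast
    have "uforce Ms i a (bs @ [b])" if "i \<in> T" for i using that by (simp add: T_def tp_def)
    then have 1: "eventually (\<lambda>k. force (Ms k) p (a k) (\<lambda>j. ((bs @ [b]) ! j) k)) U"
      unfolding p uforce_def by (intro eventually_ball_finite fin) auto
    have "eventually (\<lambda>k. force (Ms k) (IEx (length bs) p) (a k) (\<lambda>j. (bs ! j) k)) U"
      using E[unfolded hold_def] 1
    proof eventually_elim
      case (elim k)
      then show ?case using b force_append[OF p(1), of _ _ b k] by (auto simp: seqs_def)
    qed
    then have "IEx (length bs) p \<in> tp \<Theta> Ms a bs"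
      using Form_IEx[OF p(1)] by (auto simp: tp_def uforce_def)
    with sub have "uforce Ns (IEx (length bs) p) c ds" by (auto simp: tp_def)
    then show ?thesis unfolding uforce_def
    proof eventually_elim
      case (elim k)
      then show ?case by (auto simp: P_def p len)
    qed
  qed
  from countably_saturated[where P = P, OF ne this] obtain d
    where d: "\<And>k. d k \<in> Dom (Ns k)" "\<And>i. eventually (\<lambda>k. P i k (d k)) U" by blast
  have "hold Ns LE [c, d]" using d(2)[of IBot] by (auto simp: hold_def P_def elim: eventually_mono)
  moreover have "i \<in> tp \<Theta> Ns c (ds @ [d])" if "i \<in> T" for i
  proof (rule tpI)
    show "i \<in> Form \<Theta> (length (ds @ [d]))" using that T by (auto simp: len)
    then have "i \<in> Form \<Theta> (Suc (length ds))" by simp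
    note * = force_append[OF this]
    show "uforce Ns i c (ds @ [d])"
      unfolding uforce_def using d(2)[of i] by eventually_elim (simp only: *, simp add: P_def that)
  qed
  ultimately show ?thesis using d(1) by (auto simp: seqs_def T_def)
qed

lemma step_universal:
  fixes Ms Ns :: "nat \<Rightarrow> 'u model"
  assumes ne: "\<And>k. Dom (Ms k) \<noteq> {}" and c': "c' \<in> seqs Ns" and d: "d \<in> seqs Ns"
    and len: "length bs = length ds" and sub: "tp \<Theta> Ms a bs \<subseteq> tp \<Theta> Ns c ds"
    and R: "hold Ns LR [c, c']" and E: "hold Ns LE [c', d]"
  shows "\<exists>a'\<in>seqs Ms. \<exists>b\<in>seqs Ms. hold Ms LR [a, a'] \<and> hold Ms LE [a', b] \<and>
    tp \<Theta> Ms a' (bs @ [b]) \<subseteq> tp \<Theta> Ns c' (ds @ [d])"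
proof -
  define T where "T = Form \<Theta> (Suc (length ds)) - tp \<Theta> Ns c' (ds @ [d])"
  \<comment> \<open>Dually to the existential step, the formulas missing from the type of
    \<open>c'\<close> with \<open>d\<close> have to be avoided. Successor and new element are chosen
    together, as a pair, because a failing \<open>IAll\<close> supplies both at once.\<close>
  define P where "P i k y \<longleftrightarrow> [a k, fst y] \<in> interp (Ms k) LR \<and> [fst y, snd y] \<in> interp (Ms k) LE \<and>
    (i \<in> T \<longrightarrow> \<not> force (Ms k) i (fst y) ((\<lambda>j. (bs ! j) k)(length bs := snd y)))" for i k y
  have "eventually (\<lambda>k. \<exists>y\<in>Dom (Ms k) \<times> Dom (Ms k). \<forall>i\<in>I. P i k y) U" if "finite I" for I
  proof -
    have fin: "finite (I \<inter> T)" using that by auto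
    have sub1: "I \<inter> T \<subseteq> Form \<Theta> (Suc (length ds))" by (auto simp: T_def)
    obtain q where q: "q \<in> Form \<Theta> (Suc (length ds))"
      "\<And>(M :: 'u model) a e. force M q a e \<longleftrightarrow> (\<exists>i\<in>I \<inter> T. force M i a e)"
      by (rule finite_disjunction[OF fin sub1]) blast
    have "\<not> uforce Ns i c' (ds @ [d])" if "i \<in> T" for i using that by (simp add: T_def tp_def)
    then have "eventually (\<lambda>k. \<forall>i\<in>I \<inter> T. \<not> force (Ns k) i (c' k) (\<lambda>j. ((ds @ [d]) ! j) k)) U"
      unfolding uforce_def by (intro eventually_ball_finite fin) (auto simp: eventually_not)
    then have 2: "eventually (\<lambda>k. \<not> force (Ns k) q (c' k) (\<lambda>j. ((ds @ [d]) ! j) k)) U"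
      by (simp add: q)
    have "eventually (\<lambda>k. \<not> force (Ns k) (IAll (length ds) q) (c k) (\<lambda>j. (ds ! j) k)) U"
      using R[unfolded hold_def] E[unfolded hold_def] 2
    proof eventually_elim
      case (elim k)
      then show ?case using c' d force_append[OF q(1), of _ _ d k] by (auto simp: seqs_def)
    qed
    then have "IAll (length ds) q \<notin> tp \<Theta> Ns c ds"
      by (simp add: tp_def uforce_def eventually_not del: force.simps)
    with sub have "\<not> uforce Ms (IAll (length ds) q) a bs"
      using Form_IAll[OF q(1)] by (auto simp: tp_def len)
    then have "eventually (\<lambda>k. \<not> force (Ms k) (IAll (length ds) q) (a k) (\<lambda>j. (bs ! j) k)) U"
      by (simp add: uforce_def eventually_not del: force.simps)
    then show ?thesis
    proof eventually_elim
      case (elim k)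
      then show ?case by (auto simp: P_def q len)
    qed
  qed
  moreover have "Dom (Ms k) \<times> Dom (Ms k) \<noteq> {}" for k using ne by simp
  ultimately obtain g
    where g: "\<And>k. g k \<in> Dom (Ms k) \<times> Dom (Ms k)" "\<And>i. eventually (\<lambda>k. P i k (g k)) U"
    using countably_saturated[of "\<lambda>k. Dom (Ms k) \<times> Dom (Ms k)" P] by blast
  define a' b where "a' k = fst (g k)" and "b k = snd (g k)" for k
  have "hold Ms LR [a, a']" "hold Ms LE [a', b]"
    using g(2)[of IBot] by (auto simp: hold_def P_def a'_def b_def elim: eventually_mono)
  moreover have "i \<in> tp \<Theta> Ns c' (ds @ [d])" if "i \<in> tp \<Theta> Ms a' (bs @ [b])" for i
  proof (rule ccontr)
    assume "i \<notin> tp \<Theta> Ns c' (ds @ [d])"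
    with that have i: "i \<in> T" by (simp add: T_def tp_def len)
    then have "i \<in> Form \<Theta> (Suc (length bs))" by (simp add: T_def len)
    note * = force_append[OF this]
    have "eventually (\<lambda>k. \<not> force (Ms k) i (a' k) (\<lambda>j. ((bs @ [b]) ! j) k)) U"
      using g(2)[of i] by eventually_elim (simp only: *, simp add: P_def i a'_def b_def)
    with that show False by (simp add: tp_def uforce_def eventually_not)
  qed
  moreover have "a' \<in> seqs Ms" "b \<in> seqs Ms"
    using g(1) by (simp_all add: seqs_def a'_def b_def mem_Times_iff)
  ultimately show ?thesis by blast
qed

end

section \<open>Countable elementary submodels of ultraproducts\<close>

lemma interp_model:
  assumes "is_model M" "l \<in> voc M" "as \<in> interp M l"
  shows "length as = arity l" "set as \<subseteq> Dom M"
  using assms unfolding is_model_def by blast+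

text \<open>
  An element of the ultraproduct is represented by the sequences in \<open>C\<close> that \<open>h\<close> identifies, so
  that \<open>fin\<close> is the image of a countable elementary submodel of the ultraproduct in the universe.
\<close>

locale ultraproduct_submodel = free_ultrafilter U for U +
  fixes Ms :: "nat \<Rightarrow> 'u model" and \<Theta> :: "letter set"
    and C :: "(nat \<Rightarrow> 'u) set" and h :: "(nat \<Rightarrow> 'u) \<Rightarrow> 'u"
  assumes models: "is_model (Ms k)" "voc (Ms k) = \<Theta>"
    and C: "C \<noteq> {}" "C \<subseteq> seqs Ms"
    and h: "x \<in> C \<Longrightarrow> y \<in> C \<Longrightarrow> h x = h y \<longleftrightarrow> eventually (\<lambda>k. x k = y k) U"
    and witness: "range s \<subseteq> C \<Longrightarrow> eventually (\<lambda>k. sat (Ms k) (\<lambda>w. s w k) (Ex v f)) U \<Longrightarrow>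
      \<exists>g\<in>C. eventually (\<lambda>k. sat (Ms k) (\<lambda>w. (s(v := g)) w k) f) U"
begin

definition fin :: "'u model" where
  "fin = \<lparr>voc = \<Theta>, Dom = h ` C, interp = (\<lambda>l. {map h fs |fs. set fs \<subseteq> C \<and> hold Ms l fs})\<rparr>"

lemma voc_fin: "voc fin = \<Theta>" and Dom_fin: "Dom fin = h ` C"
  by (simp_all add: fin_def)

lemma map_h_eq:
  assumes "set fs \<subseteq> C" "set gs \<subseteq> C" "map h fs = map h gs"
  shows "eventually (\<lambda>k. map (\<lambda>f. f k) fs = map (\<lambda>f. f k) gs) U"
  using assms
proof (induction fs arbitrary: gs)
  case (Cons f fs)
  then obtain g gs' where gs: "gs = g # gs'" by (cases gs) auto
  with Cons.prems have "eventually (\<lambda>k. f k = g k) U" using h[of f g] by simp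
  moreover have "eventually (\<lambda>k. map (\<lambda>f. f k) fs = map (\<lambda>f. f k) gs') U"
    using Cons.prems gs by (intro Cons.IH) auto
  ultimately show ?case unfolding gs by eventually_elim simp
qed simp

text \<open>By definition some preimage of the tuple has to hold. Any two preimages agree almost
  everywhere, so every preimage does.\<close>

lemma interp_fin: "set fs \<subseteq> C \<Longrightarrow> map h fs \<in> interp fin l \<longleftrightarrow> hold Ms l fs"
proof
  assume fs: "set fs \<subseteq> C" and "map h fs \<in> interp fin l"
  then obtain gs where gs: "set gs \<subseteq> C" "hold Ms l gs" "map h fs = map h gs"
    by (auto simp: fin_def)
  from map_h_eq[OF fs gs(1,3)] gs(2)[unfolded hold_def] show "hold Ms l fs"
    unfolding hold_def by eventually_elim simp
qed (auto simp: fin_def)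

lemma model_fin: "is_model fin"
proof -
  have "vocabulary \<Theta>" using models[of 0] by (simp add: is_model_def)
  moreover have "length fs = arity l" if "hold Ms l fs" "l \<in> \<Theta>" for l fs
  proof -
    \<comment> \<open>The length of \<open>fs\<close> does not depend on \<open>k\<close>, so in a
      proper filter an eventual statement about it is true outright.\<close>
    have "eventually (\<lambda>k. length fs = arity l) U" using that(1)[unfolded hold_def]
    proof eventually_elim
      case (elim k)
      then show ?case using interp_model(1)[OF models(1)[of k]] models(2) \<open>l \<in> \<Theta>\<close> by (metis length_map)
    qed
    then show ?thesis using nontrivial by (simp add: eventually_const)
  qed
  moreover have "\<not> hold Ms l fs" if "l \<notin> \<Theta>" for l fs
    using models that by (simp add: is_model_def hold_def nontrivial)
  ultimately show ?thesis using C(1) by (auto simp: is_model_def fin_def intro!: imageI)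
qed

text \<open>Los's theorem combined with the Tarski-Vaught test: \<open>witness\<close> supplies
  existential witnesses within \<open>C\<close> instead of the full product.\<close>

lemma los:
  assumes "range s \<subseteq> C"
  shows "sat fin (h \<circ> s) f \<longleftrightarrow> eventually (\<lambda>k. sat (Ms k) (\<lambda>w. s w k) f) U"
  using assms
proof (induction f arbitrary: s)
  case (Eq u v)
  then show ?case using h[of "s u" "s v"] by (simp add: image_subset_iff)
next
  case (Atom l vs)
  then have "set (map s vs) \<subseteq> C" by auto
  from interp_fin[OF this, of l] show ?case by (simp add: hold_def comp_def)
next
  case (Ex v f)
  have upd: "(h \<circ> s)(v := h g) = h \<circ> (s(v := g))" for g by (auto simp: fun_eq_iff)
  have ran: "range (s(v := g)) \<subseteq> C" if "g \<in> C" for g using Ex.prems that by auto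
  have "sat fin (h \<circ> s) (Ex v f) \<longleftrightarrow> (\<exists>g\<in>C. sat fin (h \<circ> (s(v := g))) f)"
    by (simp add: Dom_fin upd)
  also have "\<dots> \<longleftrightarrow> (\<exists>g\<in>C. eventually (\<lambda>k. sat (Ms k) (\<lambda>w. (s(v := g)) w k) f) U)"
    using Ex.IH[OF ran] by blast
  also have "\<dots> \<longleftrightarrow> eventually (\<lambda>k. sat (Ms k) (\<lambda>w. s w k) (Ex v f)) U"
  proof
    assume "\<exists>g\<in>C. eventually (\<lambda>k. sat (Ms k) (\<lambda>w. (s(v := g)) w k) f) U"
    then obtain g where g: "g \<in> C" "eventually (\<lambda>k. sat (Ms k) (\<lambda>w. (s(v := g)) w k) f) U"
      by blast
    have "(\<lambda>w. (s(v := g)) w k) = (\<lambda>w. s w k)(v := g k)" for k by auto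
    moreover have "g k \<in> Dom (Ms k)" for k using g(1) C(2) by (auto simp: seqs_def)
    ultimately have "sat (Ms k) (\<lambda>w. s w k) (Ex v f)" if "sat (Ms k) (\<lambda>w. (s(v := g)) w k) f" for k
      using that unfolding sat.simps by metis
    with g(2) show "eventually (\<lambda>k. sat (Ms k) (\<lambda>w. s w k) (Ex v f)) U"
      by (rule eventually_mono)
  next
    assume "eventually (\<lambda>k. sat (Ms k) (\<lambda>w. s w k) (Ex v f)) U"
    with witness Ex.prems
    show "\<exists>g\<in>C. eventually (\<lambda>k. sat (Ms k) (\<lambda>w. (s(v := g)) w k) f) U" by blast
  qed
  finally show ?case .
next
  case (All v f)
  have upd: "(h \<circ> s)(v := h g) = h \<circ> (s(v := g))" for g by (auto simp: fun_eq_iff)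
  have ran: "range (s(v := g)) \<subseteq> C" if "g \<in> C" for g using All.prems that by auto
  have "sat fin (h \<circ> s) (All v f) \<longleftrightarrow> (\<forall>g\<in>C. sat fin (h \<circ> (s(v := g))) f)"
    by (simp add: Dom_fin upd)
  also have "\<dots> \<longleftrightarrow> (\<forall>g\<in>C. eventually (\<lambda>k. sat (Ms k) (\<lambda>w. (s(v := g)) w k) f) U)"
    using All.IH[OF ran] by blast
  also have "\<dots> \<longleftrightarrow> eventually (\<lambda>k. sat (Ms k) (\<lambda>w. s w k) (All v f)) U"
  proof
    assume *: "eventually (\<lambda>k. sat (Ms k) (\<lambda>w. s w k) (All v f)) U"
    show "\<forall>g\<in>C. eventually (\<lambda>k. sat (Ms k) (\<lambda>w. (s(v := g)) w k) f) U"
    proof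
      fix g assume g: "g \<in> C"
      have "(\<lambda>w. (s(v := g)) w k) = (\<lambda>w. s w k)(v := g k)" for k by auto
      moreover have "g k \<in> Dom (Ms k)" for k using g C(2) by (auto simp: seqs_def)
      ultimately have "sat (Ms k) (\<lambda>w. (s(v := g)) w k) f" if "sat (Ms k) (\<lambda>w. s w k) (All v f)" for k
        using that unfolding sat.simps by metis
      with * show "eventually (\<lambda>k. sat (Ms k) (\<lambda>w. (s(v := g)) w k) f) U"
        by (rule eventually_mono)
    qed
  next
    assume *: "\<forall>g\<in>C. eventually (\<lambda>k. sat (Ms k) (\<lambda>w. (s(v := g)) w k) f) U"
    show "eventually (\<lambda>k. sat (Ms k) (\<lambda>w. s w k) (All v f)) U"
    proof (rule ccontr)
      assume "\<not> eventually (\<lambda>k. sat (Ms k) (\<lambda>w. s w k) (All v f)) U"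
      \<comment> \<open>For an ultrafilter, failing to hold almost everywhere means failing almost
        everywhere; \<open>witness\<close> then collects the counterexamples in one
        sequence.\<close>
      then have "eventually (\<lambda>k. sat (Ms k) (\<lambda>w. s w k) (Ex v (Neg f))) U"
        by (simp flip: eventually_not)
      with witness All.prems
      obtain g where "g \<in> C" "eventually (\<lambda>k. sat (Ms k) (\<lambda>w. (s(v := g)) w k) (Neg f)) U" by blast
      with * show False by (simp add: eventually_not)
    qed
  qed
  finally show ?case .
qed (simp_all add: eventually_not eventually_disj eventually_implies eventually_conj_iff)

lemma assignment_fin:
  assumes "assignment fin t"
  obtains s where "range s \<subseteq> C" "t = h \<circ> s"
proof
  have "t v \<in> h ` C" for v using assms by (auto simp: assignment_def Dom_fin)
  then show "range (inv_into C h \<circ> t) \<subseteq> C" "t = h \<circ> (inv_into C h \<circ> t)"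
    by (auto simp: fun_eq_iff f_inv_into_f inv_into_into)
qed

text \<open>The axioms hold at every coordinate, under the coordinates of any assignment, and so
  pass to \<open>fin\<close> by Los's theorem.\<close>

lemma fin_in_axiomatizable:
  assumes "axiomatizable K \<Theta>" and K: "\<And>k. Ms k \<in> K"
  shows "fin \<in> K"
proof -
  obtain Ax where "\<forall>M. is_model M \<and> voc M = \<Theta> \<longrightarrow>
    (M \<in> K \<longleftrightarrow> (\<forall>f\<in>Ax. \<forall>s. assignment M s \<longrightarrow> sat M s f))"
    using assms(1) unfolding axiomatizable_def by (elim exE conjE)
  then have Ax: "M \<in> K \<longleftrightarrow> (\<forall>f\<in>Ax. \<forall>s. assignment M s \<longrightarrow> sat M s f)"
    if "is_model M" "voc M = \<Theta>" for M using that by simp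
  have "sat fin t f" if f: "f \<in> Ax" and t: "assignment fin t" for f t
  proof -
    from t obtain s where s: "range s \<subseteq> C" "t = h \<circ> s" by (rule assignment_fin)
    have "sat (Ms k) (\<lambda>w. s w k) f" for k
    proof -
      have "s w \<in> seqs Ms" for w using s(1) C(2) by blast
      then have "assignment (Ms k) (\<lambda>w. s w k)" by (auto simp: assignment_def seqs_def)
      with Ax[OF models] K f show ?thesis by blast
    qed
    then show ?thesis using los[OF s(1)] s(2) by simp
  qed
  with Ax[OF model_fin voc_fin] show ?thesis by blast
qed

end

section \<open>Coincidence of assignments and evaluation at points\<close>

lemma sat_cong: "(\<And>v. v \<in> fv f \<Longrightarrow> s v = t v) \<Longrightarrow> sat M s f \<longleftrightarrow> sat M t f"
proof (induction f arbitrary: s t)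
  case (Atom l vs)
  then have "map s vs = map t vs" by simp
  then show ?case by (simp only: sat.simps)
next
  case (Neg f)
  have "sat M s f = sat M t f" by (rule Neg.IH) (use Neg.prems in auto)
  then show ?case by simp
next
  case (Conj f g)
  have "sat M s f = sat M t f" by (rule Conj.IH(1)) (use Conj.prems in auto)
  moreover have "sat M s g = sat M t g" by (rule Conj.IH(2)) (use Conj.prems in auto)
  ultimately show ?case by simp
next
  case (Disj f g)
  have "sat M s f = sat M t f" by (rule Disj.IH(1)) (use Disj.prems in auto)
  moreover have "sat M s g = sat M t g" by (rule Disj.IH(2)) (use Disj.prems in auto)
  ultimately show ?case by simp
next
  case (Imp f g)
  have "sat M s f = sat M t f" by (rule Imp.IH(1)) (use Imp.prems in auto)
  moreover have "sat M s g = sat M t g" by (rule Imp.IH(2)) (use Imp.prems in auto)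
  ultimately show ?case by simp
next
  case (Ex v f)
  have "sat M (s(v := d)) f = sat M (t(v := d)) f" for d by (rule Ex.IH) (use Ex.prems in auto)
  then show ?case by simp
next
  case (All v f)
  have "sat M (s(v := d)) f = sat M (t(v := d)) f" for d by (rule All.IH) (use All.prems in auto)
  then show ?case by simp
qed simp

lemma sat_at_iff:
  assumes "assignment M s" "fv f \<subseteq> insert (X 0) (W ` {..<length bs})"
    "s (X 0) = a" "\<And>i. i < length bs \<Longrightarrow> s (W i) = bs ! i"
  shows "sat_at M a bs f \<longleftrightarrow> sat M s f"
proof
  show "sat_at M a bs f \<Longrightarrow> sat M s f" using assms by (simp add: sat_at_def)
next
  assume s: "sat M s f"
  show "sat_at M a bs f" unfolding sat_at_def
  proof (intro allI impI)
    fix t assume t: "assignment M t \<and> t (X 0) = a \<and> (\<forall>i<length bs. t (W i) = bs ! i)"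
    have "sat M t f \<longleftrightarrow> sat M s f"
      by (rule sat_cong) (use t assms in auto)
    with s show "sat M t f" by simp
  qed
qed

lemma sat_at_Atom:
  assumes "a \<in> Dom M" "set bs \<subseteq> Dom M" "set js \<subseteq> {..<length bs}"
  shows "sat_at M a bs (Atom l (X 0 # map W js)) \<longleftrightarrow> a # map ((!) bs) js \<in> interp M l"
proof -
  \<comment> \<open>The default \<open>a\<close> keeps the remaining variables inside the
    domain.\<close>
  define s where "s v = (case v of X _ \<Rightarrow> a | W j \<Rightarrow> if j < length bs then bs ! j else a)" for v
  have "s v \<in> Dom M" for v using assms by (auto simp: s_def split: var.split)
  then have "assignment M s" by (auto simp: assignment_def)
  then have "sat_at M a bs (Atom l (X 0 # map W js)) \<longleftrightarrow> sat M s (Atom l (X 0 # map W js))"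
    by (rule sat_at_iff) (use assms in \<open>auto simp: s_def\<close>)
  moreover have "map s (map W js) = map ((!) bs) js" using assms(3) by (auto simp: s_def)
  moreover have "s (X 0) = a" by (simp add: s_def)
  ultimately show ?thesis by (simp only: sat.simps list.map)
qed

section \<open>A pair of submodels with an asimulation\<close>

text \<open>Indexing the sides by \<open>bool\<close> states each closure property for both
  orientations, as condition (2) reverses pairs. The closure assumptions place the witnesses of the
  three steps inside \<open>C\<close>; disjointness lets an element determine its side.\<close>

locale ultraproduct_pair = free_ultrafilter U for U +
  fixes Ms :: "bool \<Rightarrow> nat \<Rightarrow> 'u model" and \<Theta> :: "letter set"
    and C :: "bool \<Rightarrow> (nat \<Rightarrow> 'u) set" and h :: "bool \<Rightarrow> (nat \<Rightarrow> 'u) \<Rightarrow> 'u"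
  assumes side: "ultraproduct_submodel U (Ms b) \<Theta> (C b) (h b)"
    and disjoint: "h True ` C True \<inter> h False ` C False = {}"
    and closed_implication: "{a} \<union> set bs \<subseteq> C b \<Longrightarrow> {c, c'} \<union> set ds \<subseteq> C (\<not> b) \<Longrightarrow>
      length bs = length ds \<Longrightarrow> tp \<Theta> (Ms b) a bs \<subseteq> tp \<Theta> (Ms (\<not> b)) c ds \<Longrightarrow>
      hold (Ms (\<not> b)) LR [c, c'] \<Longrightarrow>
      \<exists>a'\<in>C b. hold (Ms b) LR [a, a'] \<and> tp \<Theta> (Ms b) a' bs = tp \<Theta> (Ms (\<not> b)) c' ds"
    and closed_existential: "{a, x} \<union> set bs \<subseteq> C b \<Longrightarrow> {c} \<union> set ds \<subseteq> C (\<not> b) \<Longrightarrow>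
      length bs = length ds \<Longrightarrow> tp \<Theta> (Ms b) a bs \<subseteq> tp \<Theta> (Ms (\<not> b)) c ds \<Longrightarrow>
      hold (Ms b) LE [a, x] \<Longrightarrow>
      \<exists>y\<in>C (\<not> b). hold (Ms (\<not> b)) LE [c, y] \<and>
        tp \<Theta> (Ms b) a (bs @ [x]) \<subseteq> tp \<Theta> (Ms (\<not> b)) c (ds @ [y])"
    and closed_universal: "{a} \<union> set bs \<subseteq> C b \<Longrightarrow> {c, c', y} \<union> set ds \<subseteq> C (\<not> b) \<Longrightarrow>
      length bs = length ds \<Longrightarrow> tp \<Theta> (Ms b) a bs \<subseteq> tp \<Theta> (Ms (\<not> b)) c ds \<Longrightarrow>
      hold (Ms (\<not> b)) LR [c, c'] \<Longrightarrow> hold (Ms (\<not> b)) LE [c', y] \<Longrightarrow>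
      \<exists>a'\<in>C b. \<exists>x\<in>C b. hold (Ms b) LR [a, a'] \<and> hold (Ms b) LE [a', x] \<and>
        tp \<Theta> (Ms b) a' (bs @ [x]) \<subseteq> tp \<Theta> (Ms (\<not> b)) c' (ds @ [y])"
begin

sublocale S: ultraproduct_submodel U "Ms b" \<Theta> "C b" "h b" for b
  by (rule side)

text \<open>One relation contains both orientations, \<open>b\<close> being the side of the left
  component. Inclusion is required for some representing sequences only, and the verification
  continues with those.\<close>

definition A :: "(('u \<times> 'u list) \<times> ('u \<times> 'u list)) set" where
  "A = {((h b a, map (h b) bs), (h (\<not> b) c, map (h (\<not> b)) ds)) | b a bs c ds.
     {a} \<union> set bs \<subseteq> C b \<and> {c} \<union> set ds \<subseteq> C (\<not> b) \<and> length bs = length ds \<and>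
     tp \<Theta> (Ms b) a bs \<subseteq> tp \<Theta> (Ms (\<not> b)) c ds}"

lemma AI:
  "{a} \<union> set bs \<subseteq> C b \<Longrightarrow> {c} \<union> set ds \<subseteq> C (\<not> b) \<Longrightarrow> length bs = length ds \<Longrightarrow>
     tp \<Theta> (Ms b) a bs \<subseteq> tp \<Theta> (Ms (\<not> b)) c ds \<Longrightarrow>
   ((h b a, map (h b) bs), (h (\<not> b) c, map (h (\<not> b)) ds)) \<in> A"
  unfolding A_def by blast

lemma AE:
  assumes "((a', bs'), (c', ds')) \<in> A"
  obtains b a bs c ds where "a' = h b a" "bs' = map (h b) bs" "c' = h (\<not> b) c"
    "ds' = map (h (\<not> b)) ds" "{a} \<union> set bs \<subseteq> C b" "{c} \<union> set ds \<subseteq> C (\<not> b)"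
    "length bs = length ds" "tp \<Theta> (Ms b) a bs \<subseteq> tp \<Theta> (Ms (\<not> b)) c ds"
  using assms unfolding A_def mem_Collect_eq prod.inject
  by (elim exE conjE) (rule that)

lemma Dom_disjoint: "x \<in> Dom (S.fin b) \<Longrightarrow> x \<in> Dom (S.fin b') \<Longrightarrow> b = b'"
  using disjoint by (cases b; cases b') (auto simp: S.Dom_fin)

lemma interp_fin2:
  assumes "[h b a, y] \<in> interp (S.fin b) l" "l \<in> {LR, LE}" "a \<in> C b"
  obtains z where "z \<in> C b" "y = h b z" "hold (Ms b) l [a, z]"
proof -
  have "l \<in> \<Theta>" using S.model_fin[of True] assms(2) by (auto simp: is_model_def vocabulary_def S.voc_fin)
  then have "y \<in> Dom (S.fin b)" using interp_model(2)[OF S.model_fin _ assms(1)]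
    by (simp add: S.voc_fin)
  then obtain z where z: "z \<in> C b" "y = h b z" by (auto simp: S.Dom_fin)
  with assms S.interp_fin[of "[a, z]" b l] that show ?thesis by simp
qed

lemma hold_fin2: "hold (Ms b) l [a, z] \<Longrightarrow> a \<in> C b \<Longrightarrow> z \<in> C b \<Longrightarrow> [h b a, h b z] \<in> interp (S.fin b) l"
  using S.interp_fin[of "[a, z]" b l] by simp

text \<open>An atom with first argument \<open>x\<close> is the translation of an intuitionistic
  atom, hence among the formulas that the types compare.\<close>

lemma A_atom:
  assumes "{a} \<union> set bs \<subseteq> C b" "{c} \<union> set ds \<subseteq> C (\<not> b)" and len: "length bs = length ds"
    and sub: "tp \<Theta> (Ms b) a bs \<subseteq> tp \<Theta> (Ms (\<not> b)) c ds"
    and Q: "Q \<in> \<Theta> - {LR, LE}" "Suc (length js) = arity Q" "set js \<subseteq> {..<length bs}"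
    and sat: "sat_at (S.fin b) (h b a) (map (h b) bs) (Atom Q (X 0 # map W js))"
  shows "sat_at (S.fin (\<not> b)) (h (\<not> b) c) (map (h (\<not> b)) ds) (Atom Q (X 0 # map W js))"
proof -
  have *: "sat_at (S.fin b) (h b a) (map (h b) bs) (Atom Q (X 0 # map W js)) \<longleftrightarrow>
      IAtom Q js \<in> tp \<Theta> (Ms b) a bs"
    if "{a} \<union> set bs \<subseteq> C b" "set js \<subseteq> {..<length bs}" for b a bs
  proof -
    have "sat_at (S.fin b) (h b a) (map (h b) bs) (Atom Q (X 0 # map W js)) \<longleftrightarrow>
        h b a # map ((!) (map (h b) bs)) js \<in> interp (S.fin b) Q"
      by (rule sat_at_Atom) (use that in \<open>auto simp: S.Dom_fin\<close>)
    also have "h b a # map ((!) (map (h b) bs)) js = map (h b) (a # map ((!) bs) js)"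
      using that(2) by auto
    also have "\<dots> \<in> interp (S.fin b) Q \<longleftrightarrow> hold (Ms b) Q (a # map ((!) bs) js)"
      by (rule S.interp_fin) (use that in \<open>auto simp: subset_iff\<close>)
    also have "\<dots> \<longleftrightarrow> uforce (Ms b) (IAtom Q js) a bs"
      by (simp add: hold_def uforce_def comp_def)
    finally show ?thesis using Q(1,2) that(2) by (auto simp: tp_def Form_def)
  qed
  have "IAtom Q js \<in> tp \<Theta> (Ms b) a bs" using *[OF assms(1) Q(3)] sat by blast
  with sub have "IAtom Q js \<in> tp \<Theta> (Ms (\<not> b)) c ds" by blast
  then show ?thesis using *[OF assms(2)] Q(3) len by simp
qed

lemma asimulation_A:
  assumes "{a} \<union> set bs \<subseteq> C True" "{c} \<union> set ds \<subseteq> C False" "length bs = length ds"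
    "tp \<Theta> (Ms True) a bs \<subseteq> tp \<Theta> (Ms False) c ds"
  shows "asimulation (S.fin True) (h True a) (map (h True) bs)
    (S.fin False) (h False c) (map (h False) ds) A"
  unfolding asimulation_def
proof (intro conjI)
  show "\<forall>a' bs' c' ds'. ((a', bs'), (c', ds')) \<in> A \<longrightarrow> length bs' = length ds' \<and>
       (insert a' (set bs') \<subseteq> Dom (S.fin True) \<and> insert c' (set ds') \<subseteq> Dom (S.fin False) \<or>
        insert a' (set bs') \<subseteq> Dom (S.fin False) \<and> insert c' (set ds') \<subseteq> Dom (S.fin True))"
  proof (intro allI impI)
    fix a' bs' c' ds' assume "((a', bs'), (c', ds')) \<in> A"
    then obtain b a bs c ds where "a' = h b a" "bs' = map (h b) bs" "c' = h (\<not> b) c"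
      "ds' = map (h (\<not> b)) ds" "{a} \<union> set bs \<subseteq> C b" "{c} \<union> set ds \<subseteq> C (\<not> b)" "length bs = length ds"
      by (rule AE)
    then show "length bs' = length ds' \<and>
       (insert a' (set bs') \<subseteq> Dom (S.fin True) \<and> insert c' (set ds') \<subseteq> Dom (S.fin False) \<or>
        insert a' (set bs') \<subseteq> Dom (S.fin False) \<and> insert c' (set ds') \<subseteq> Dom (S.fin True))"
      by (cases b) (auto simp: S.Dom_fin)
  qed
  show "((h True a, map (h True) bs), h False c, map (h False) ds) \<in> A"
    using AI[of a bs True c ds] assms by simp
  show "\<forall>\<alpha>\<in>{S.fin True, S.fin False}. \<forall>\<beta>\<in>{S.fin True, S.fin False}. \<forall>a' bs' c' ds'.
       ((a', bs'), (c', ds')) \<in> A \<and>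
       insert a' (set bs') \<subseteq> Dom \<alpha> \<and> insert c' (set ds') \<subseteq> Dom \<beta> \<longrightarrow>
       (\<forall>Q\<in>voc (S.fin True) - {LR, LE}. \<forall>js. Suc (length js) = arity Q \<and> set js \<subseteq> {..<length bs'} \<longrightarrow>
          sat_at \<alpha> a' bs' (Atom Q (X 0 # map W js)) \<longrightarrow>
          sat_at \<beta> c' ds' (Atom Q (X 0 # map W js))) \<and>
       (\<forall>c''. [c', c''] \<in> interp \<beta> LR \<longrightarrow>
          (\<exists>a''\<in>Dom \<alpha>. [a', a''] \<in> interp \<alpha> LR \<and>
             ((c'', ds'), (a'', bs')) \<in> A \<and> ((a'', bs'), (c'', ds')) \<in> A)) \<and>
       (\<forall>b''. [a', b''] \<in> interp \<alpha> LE \<longrightarrow>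
          (\<exists>d''\<in>Dom \<beta>. [c', d''] \<in> interp \<beta> LE \<and>
             ((a', bs' @ [b'']), (c', ds' @ [d''])) \<in> A)) \<and>
       (\<forall>c'' d''. [c', c''] \<in> interp \<beta> LR \<and> [c'', d''] \<in> interp \<beta> LE \<longrightarrow>
          (\<exists>a''\<in>Dom \<alpha>. \<exists>b''\<in>Dom \<alpha>. [a', a''] \<in> interp \<alpha> LR \<and> [a'', b''] \<in> interp \<alpha> LE \<and>
             ((a'', bs' @ [b'']), (c'', ds' @ [d''])) \<in> A))"
    (is "\<forall>\<alpha>\<in>_. \<forall>\<beta>\<in>_. \<forall>a' bs' c' ds'. _ \<longrightarrow> ?P \<alpha> \<beta> a' bs' c' ds'")
  proof (intro ballI allI impI, elim conjE)
    fix \<alpha> \<beta> a' bs' c' ds'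
    assume \<alpha>: "\<alpha> \<in> {S.fin True, S.fin False}" "insert a' (set bs') \<subseteq> Dom \<alpha>"
      and \<beta>: "\<beta> \<in> {S.fin True, S.fin False}" "insert c' (set ds') \<subseteq> Dom \<beta>"
      and inA: "((a', bs'), (c', ds')) \<in> A"
    from inA obtain b a bs c ds where eqs: "a' = h b a" "bs' = map (h b) bs" "c' = h (\<not> b) c"
      "ds' = map (h (\<not> b)) ds" and mem: "{a} \<union> set bs \<subseteq> C b" "{c} \<union> set ds \<subseteq> C (\<not> b)"
      and len: "length bs = length ds" and sub: "tp \<Theta> (Ms b) a bs \<subseteq> tp \<Theta> (Ms (\<not> b)) c ds"
      by (rule AE)
    have dom: "a' \<in> Dom (S.fin b)" "c' \<in> Dom (S.fin (\<not> b))" using eqs mem by (auto simp: S.Dom_fin)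
    obtain b1 b2 where b12: "\<alpha> = S.fin b1" "\<beta> = S.fin b2" using \<alpha>(1) \<beta>(1) by blast
    \<comment> \<open>The given models are arbitrary members of the pair; disjoint domains rule out
      every reading except the orientation recorded by \<open>b\<close>.\<close>
    have "b1 = b" by (rule Dom_disjoint[of a']) (use \<alpha>(2) b12 dom in simp_all)
    then have \<alpha>b: "\<alpha> = S.fin b" using b12 by simp
    have "b2 = (\<not> b)" by (rule Dom_disjoint[of c']) (use \<beta>(2) b12 dom in simp_all)
    then have \<beta>b: "\<beta> = S.fin (\<not> b)" using b12 by simp
    show "?P \<alpha> \<beta> a' bs' c' ds'"
    proof (intro conjI allI ballI impI, goal_cases)
      case (1 Q js)
      then show ?case unfolding \<alpha>b \<beta>b eqs
        using A_atom[OF mem len sub, of Q js] by (auto simp: S.voc_fin)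
    next
      case (2 c'')
      then obtain z where z: "z \<in> C (\<not> b)" "c'' = h (\<not> b) z" "hold (Ms (\<not> b)) LR [c, z]"
        unfolding \<beta>b eqs by (rule interp_fin2) (use mem in auto)
      then obtain y where y: "y \<in> C b" "hold (Ms b) LR [a, y]"
        and eq: "tp \<Theta> (Ms b) y bs = tp \<Theta> (Ms (\<not> b)) z ds"
        using closed_implication[of a bs b c z ds] mem len sub by auto
      have "((h b y, bs'), (c'', ds')) \<in> A"
        unfolding eqs z using AI[of y bs b z ds] y z mem len eq by auto
      \<comment> \<open>The reversed pair uses the other inclusion contained in the equality of
        types.\<close>
      moreover have "((c'', ds'), (h b y, bs')) \<in> A"
        unfolding eqs z using AI[of z ds "\<not> b" y bs] y z mem len eq by auto
      moreover have "[a', h b y] \<in> interp \<alpha> LR"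
        unfolding \<alpha>b eqs using y mem by (intro hold_fin2) auto
      ultimately show ?case using y(1) by (auto simp: \<alpha>b S.Dom_fin)
    next
      case (3 b'')
      then obtain x where x: "x \<in> C b" "b'' = h b x" "hold (Ms b) LE [a, x]"
        unfolding \<alpha>b eqs by (rule interp_fin2) (use mem in auto)
      then obtain y where y: "y \<in> C (\<not> b)" "hold (Ms (\<not> b)) LE [c, y]"
        and le: "tp \<Theta> (Ms b) a (bs @ [x]) \<subseteq> tp \<Theta> (Ms (\<not> b)) c (ds @ [y])"
        using closed_existential[of a x bs b c ds] mem len sub by auto
      have "((a', bs' @ [b'']), (c', ds' @ [h (\<not> b) y])) \<in> A"
        unfolding eqs x using AI[of a "bs @ [x]" b c "ds @ [y]"] x y mem len le by auto
      moreover have "[c', h (\<not> b) y] \<in> interp \<beta> LE"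
        unfolding \<beta>b eqs using y mem by (intro hold_fin2) auto
      ultimately show ?case using y(1) by (auto simp: \<beta>b S.Dom_fin)
    next
      case (4 c'' d'')
      then have "[c', c''] \<in> interp \<beta> LR" "[c'', d''] \<in> interp \<beta> LE" by auto
      then obtain z where z: "z \<in> C (\<not> b)" "c'' = h (\<not> b) z" "hold (Ms (\<not> b)) LR [c, z]"
        unfolding \<beta>b eqs by (elim interp_fin2) (use mem in auto)
      from \<open>[c'', d''] \<in> interp \<beta> LE\<close>
      obtain u where u: "u \<in> C (\<not> b)" "d'' = h (\<not> b) u" "hold (Ms (\<not> b)) LE [z, u]"
        unfolding \<beta>b z(2) by (elim interp_fin2) (use z in auto)
      obtain y x where y: "y \<in> C b" "hold (Ms b) LR [a, y]" and x: "x \<in> C b" "hold (Ms b) LE [y, x]"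
        and le: "tp \<Theta> (Ms b) y (bs @ [x]) \<subseteq> tp \<Theta> (Ms (\<not> b)) z (ds @ [u])"
        using closed_universal[of a bs b c z u ds] mem len sub z u by auto
      have "((h b y, bs' @ [h b x]), (c'', ds' @ [d''])) \<in> A"
        unfolding eqs z u using AI[of y "bs @ [x]" b z "ds @ [u]"] x y z u mem len le by auto
      moreover have "[a', h b y] \<in> interp \<alpha> LR" "[h b y, h b x] \<in> interp \<alpha> LE"
        unfolding \<alpha>b eqs using x y mem by (auto intro: hold_fin2)
      ultimately show ?case using x(1) y(1) by (auto simp: \<alpha>b S.Dom_fin)
    qed
  qed
qed

end

section \<open>Witness requests and their joint countable closure\<close>

context free_ultrafilter
begin

text \<open>Requests take finite parameter lists, so only the values at the variables
  \<open>vs\<close> are passed instead of a whole assignment. Other variables get unspecified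
  values, which do not matter once \<open>vs\<close> lists the free variables of
  \<open>f\<close>.\<close>

definition skolem_request :: "(nat \<Rightarrow> 'u model) \<Rightarrow> fm \<Rightarrow> var \<Rightarrow> var list \<Rightarrow>
    (nat \<Rightarrow> 'u) list \<Rightarrow> (nat \<Rightarrow> 'u) list \<Rightarrow> bool" where
  "skolem_request Ms f v vs xs zs \<longleftrightarrow> (\<exists>z. zs = [z] \<and> z \<in> seqs Ms \<and>
     eventually (\<lambda>k. sat (Ms k) (\<lambda>w. ((\<lambda>u. the (map_of (zip vs xs) u))(v := z)) w k) f) U)"

lemma skolem_request_map:
  assumes "set vs = fv f"
  shows "skolem_request Ms f v vs (map s vs) zs \<longleftrightarrow> (\<exists>z. zs = [z] \<and> z \<in> seqs Ms \<and>
     eventually (\<lambda>k. sat (Ms k) (\<lambda>w. (s(v := z)) w k) f) U)"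
proof -
  have "sat (Ms k) (\<lambda>w. ((\<lambda>u. the (map_of (zip vs (map s vs)) u))(v := z)) w k) f \<longleftrightarrow>
      sat (Ms k) (\<lambda>w. (s(v := z)) w k) f" for k z
    by (rule sat_cong) (simp add: map_of_zip_map assms)
  then show ?thesis by (simp add: skolem_request_def)
qed

lemma skolem_request_ex:
  assumes "range s \<subseteq> seqs Ms" and ne: "\<And>k. Dom (Ms k) \<noteq> {}" and "set vs = fv f"
    and ex: "eventually (\<lambda>k. sat (Ms k) (\<lambda>w. s w k) (Ex v f)) U"
  shows "\<exists>zs. skolem_request Ms f v vs (map s vs) zs"
proof -
  \<comment> \<open>At coordinates where the existential formula fails any element will do, so that
    a sequence defined everywhere results.\<close>
  have "\<exists>d\<in>Dom (Ms k). sat (Ms k) (\<lambda>w. s w k) (Ex v f) \<longrightarrow> sat (Ms k) ((\<lambda>w. s w k)(v := d)) f" for k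
    using ne[of k] by auto
  then obtain g where g: "\<And>k. g k \<in> Dom (Ms k)"
    "\<And>k. sat (Ms k) (\<lambda>w. s w k) (Ex v f) \<Longrightarrow> sat (Ms k) ((\<lambda>w. s w k)(v := g k)) f" by metis
  have upd: "(\<lambda>w. (s(v := g)) w k) = (\<lambda>w. s w k)(v := g k)" for k by auto
  have "eventually (\<lambda>k. sat (Ms k) (\<lambda>w. (s(v := g)) w k) f) U"
    using ex by (rule eventually_mono) (simp only: upd g(2))
  then show ?thesis using g(1) by (auto simp: skolem_request_map[OF assms(3)] seqs_def)
qed

text \<open>
  The parameters of a step are packed into one list: first the distinguished elements, then the
  tuple \<open>bs\<close> of length \<open>m\<close>, then \<open>ds\<close>.
\<close>

definition implication_request :: "letter set \<Rightarrow> (nat \<Rightarrow> 'u model) \<Rightarrow> (nat \<Rightarrow> 'u model) \<Rightarrow> nat \<Rightarrow>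
    (nat \<Rightarrow> 'u) list \<Rightarrow> (nat \<Rightarrow> 'u) list \<Rightarrow> bool" where
  "implication_request \<Theta> Ms Ns m xs zs \<longleftrightarrow> (\<exists>z\<in>seqs Ms. zs = [z] \<and> hold Ms LR [xs ! 0, z] \<and>
     tp \<Theta> Ms z (take m (drop 2 xs)) = tp \<Theta> Ns (xs ! 1) (drop m (drop 2 xs)))"

text \<open>Here \<open>m\<close> is to be the length of the left tuple already extended by the
  element that \<open>z\<close> has to match.\<close>

definition existential_request :: "letter set \<Rightarrow> (nat \<Rightarrow> 'u model) \<Rightarrow> (nat \<Rightarrow> 'u model) \<Rightarrow> nat \<Rightarrow>
    (nat \<Rightarrow> 'u) list \<Rightarrow> (nat \<Rightarrow> 'u) list \<Rightarrow> bool" where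
  "existential_request \<Theta> Ms Ns m xs zs \<longleftrightarrow> (\<exists>z\<in>seqs Ns. zs = [z] \<and> hold Ns LE [xs ! 1, z] \<and>
     tp \<Theta> Ms (xs ! 0) (take m (drop 2 xs)) \<subseteq> tp \<Theta> Ns (xs ! 1) (drop m (drop 2 xs) @ [z]))"

definition universal_request :: "letter set \<Rightarrow> (nat \<Rightarrow> 'u model) \<Rightarrow> (nat \<Rightarrow> 'u model) \<Rightarrow> nat \<Rightarrow>
    (nat \<Rightarrow> 'u) list \<Rightarrow> (nat \<Rightarrow> 'u) list \<Rightarrow> bool" where
  "universal_request \<Theta> Ms Ns m xs zs \<longleftrightarrow> (\<exists>z\<in>seqs Ms. \<exists>x\<in>seqs Ms. zs = [z, x] \<and>
     hold Ms LR [xs ! 0, z] \<and> hold Ms LE [z, x] \<and>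
     tp \<Theta> Ms z (take m (drop 2 xs) @ [x]) \<subseteq> tp \<Theta> Ns (xs ! 1) (drop m (drop 2 xs)))"

lemma ex_ultraproduct_pair:
  fixes Ms :: "bool \<Rightarrow> nat \<Rightarrow> 'u model" and S :: "(nat \<Rightarrow> 'u) set"
  assumes inf: "infinite (UNIV :: 'u set)"
    and models: "\<And>b k. is_model (Ms b k)" "\<And>b k. voc (Ms b k) = \<Theta>"
    and S: "countable S" "\<And>b. S \<inter> seqs (Ms b) \<noteq> {}"
  obtains C h where "ultraproduct_pair U Ms \<Theta> C h" "\<And>b. S \<inter> seqs (Ms b) \<subseteq> C b"
proof -
  have ne: "Dom (Ms b k) \<noteq> {}" for b k using models(1)[of b k] by (simp add: is_model_def)
  define PS where "PS = range (\<lambda>(b, f, v, vs). skolem_request (Ms b) f v vs)"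
  define PI where "PI = range (\<lambda>(b, m). implication_request \<Theta> (Ms b) (Ms (\<not> b)) m)"
  define PE where "PE = range (\<lambda>(b, m). existential_request \<Theta> (Ms b) (Ms (\<not> b)) m)"
  define PU where "PU = range (\<lambda>(b, m). universal_request \<Theta> (Ms b) (Ms (\<not> b)) m)"
  \<comment> \<open>Each family is indexed by a countable type of formulas, variables, lists and
    numbers.\<close>
  have "countable (PS \<union> PI \<union> PE \<union> PU)" by (simp add: PS_def PI_def PE_def PU_def)
  from countable_witness_closure[OF this S(1)] obtain C0 where C0: "countable C0" "S \<subseteq> C0"
    and closed: "\<And>P xs ys. P \<in> PS \<union> PI \<union> PE \<union> PU \<Longrightarrow> set xs \<subseteq> C0 \<Longrightarrow> P xs ys \<Longrightarrow>
      \<exists>zs. set zs \<subseteq> C0 \<and> P xs zs" by blast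
  have PS: "skolem_request (Ms b) f v vs \<in> PS \<union> PI \<union> PE \<union> PU" for b f v vs
    using rangeI[of "\<lambda>(b, f, v, vs). skolem_request (Ms b) f v vs" "(b, f, v, vs)"]
    unfolding PS_def by simp
  have PI: "implication_request \<Theta> (Ms b) (Ms (\<not> b)) m \<in> PS \<union> PI \<union> PE \<union> PU" for b m
    using rangeI[of "\<lambda>(b, m). implication_request \<Theta> (Ms b) (Ms (\<not> b)) m" "(b, m)"]
    unfolding PI_def by simp
  have PE: "existential_request \<Theta> (Ms b) (Ms (\<not> b)) m \<in> PS \<union> PI \<union> PE \<union> PU" for b m
    using rangeI[of "\<lambda>(b, m). existential_request \<Theta> (Ms b) (Ms (\<not> b)) m" "(b, m)"]
    unfolding PE_def by simp
  have PU: "universal_request \<Theta> (Ms b) (Ms (\<not> b)) m \<in> PS \<union> PI \<union> PE \<union> PU" for b m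
    using rangeI[of "\<lambda>(b, m). universal_request \<Theta> (Ms b) (Ms (\<not> b)) m" "(b, m)"]
    unfolding PU_def by simp
  \<comment> \<open>One closed set serves both sides: every request demands that its answer be a
    sequence of the proper side.\<close>
  define C where "C b = C0 \<inter> seqs (Ms b)" for b
  obtain \<iota> :: "nat \<Rightarrow> 'u" where \<iota>: "inj \<iota>"
    using infinite_countable_subset[OF inf] by blast
  \<comment> \<open>A canonical representative of each class: the chosen element depends on the
    class of \<open>x\<close> alone.\<close>
  define rep where "rep x = (SOME y. y \<in> C0 \<and> eventually (\<lambda>k. x k = y k) U)" for x
  \<comment> \<open>Even codes for one side and odd codes for the other keep the images disjoint,
    even if a sequence belongs to both sides.\<close>
  define h where "h b x = \<iota> (2 * to_nat_on C0 (rep x) + of_bool b)" for b x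
  have rep: "rep x \<in> C0" "eventually (\<lambda>k. x k = rep x k) U" if "x \<in> C0" for x
    using someI[of "\<lambda>y. y \<in> C0 \<and> eventually (\<lambda>k. x k = y k) U" x] that by (auto simp: rep_def)
  have rep_eq: "rep x = rep y \<longleftrightarrow> eventually (\<lambda>k. x k = y k) U" if "x \<in> C0" "y \<in> C0" for x y
  proof
    assume "rep x = rep y"
    with rep(2)[OF that(1)] rep(2)[OF that(2)] show "eventually (\<lambda>k. x k = y k) U"
      by (auto elim: eventually_elim2)
  next
    assume eq: "eventually (\<lambda>k. x k = y k) U"
    have "eventually (\<lambda>k. x k = z k) U \<longleftrightarrow> eventually (\<lambda>k. y k = z k) U" for z
      by (rule eventually_subst) (use eq in eventually_elim, simp)
    then show "rep x = rep y" by (simp add: rep_def)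
  qed
  have h_eq: "h b x = h b' y \<longleftrightarrow> b = b' \<and> rep x = rep y" if "x \<in> C0" "y \<in> C0" for b b' x y
  proof -
    have "h b x = h b' y \<longleftrightarrow>
        2 * to_nat_on C0 (rep x) + of_bool b = 2 * to_nat_on C0 (rep y) + (of_bool b' :: nat)"
      using \<iota> by (simp add: h_def inj_eq)
    also have "\<dots> \<longleftrightarrow> b = b' \<and> to_nat_on C0 (rep x) = to_nat_on C0 (rep y)"
      by (cases b; cases b') (simp_all, presburger+)
    also have "\<dots> \<longleftrightarrow> b = b' \<and> rep x = rep y"
      using inj_on_eq_iff[OF inj_on_to_nat_on[OF C0(1)]] rep(1) that by blast
    finally show ?thesis .
  qed
  have "ultraproduct_pair U Ms \<Theta> C h"
  proof (rule ultraproduct_pair.intro[OF free_ultrafilter_axioms], rule ultraproduct_pair_axioms.intro)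
    fix b
    show "ultraproduct_submodel U (Ms b) \<Theta> (C b) (h b)"
    proof unfold_locales
      show "is_model (Ms b k)" "voc (Ms b k) = \<Theta>" for k using models by auto
      show "C b \<noteq> {}" "C b \<subseteq> seqs (Ms b)" using S(2)[of b] C0(2) by (auto simp: C_def)
      show "h b x = h b y \<longleftrightarrow> eventually (\<lambda>k. x k = y k) U" if "x \<in> C b" "y \<in> C b" for x y
        using that by (simp add: h_eq rep_eq C_def)
      show "\<exists>g\<in>C b. eventually (\<lambda>k. sat (Ms b k) (\<lambda>w. (s(v := g)) w k) f) U"
        if s: "range s \<subseteq> C b" and ex: "eventually (\<lambda>k. sat (Ms b k) (\<lambda>w. s w k) (Ex v f)) U" for s v f
      proof -
        have "finite (fv f)" by (induction f) auto
        then obtain vs where vs: "set vs = fv f" using finite_list by blast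
        have s': "range s \<subseteq> seqs (Ms b)" "set (map s vs) \<subseteq> C0" using s by (auto simp: C_def)
        obtain ys where "skolem_request (Ms b) f v vs (map s vs) ys"
          using skolem_request_ex[OF s'(1) ne vs ex] by blast
        from closed[OF PS s'(2) this] obtain zs
          where "set zs \<subseteq> C0" "skolem_request (Ms b) f v vs (map s vs) zs" by blast
        then show ?thesis unfolding skolem_request_map[OF vs] C_def by auto
      qed
    qed
  next
    show "h True ` C True \<inter> h False ` C False = {}" by (auto simp: h_eq C_def)
  next
    fix a bs b c c' ds
    assume mem: "{a} \<union> set bs \<subseteq> C b" "{c, c'} \<union> set ds \<subseteq> C (\<not> b)"
      and len: "length bs = length ds" and sub: "tp \<Theta> (Ms b) a bs \<subseteq> tp \<Theta> (Ms (\<not> b)) c ds"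
      and R: "hold (Ms (\<not> b)) LR [c, c']"
    \<comment> \<open>The point \<open>c\<close> is no parameter of the request: it only guarantees,
      through the step lemma, that an answer exists.\<close>
    have "c' \<in> seqs (Ms (\<not> b))" and xs: "set (a # c' # bs @ ds) \<subseteq> C0" using mem by (auto simp: C_def)
    from step_implication[OF ne this(1) len sub R] obtain z where
      "implication_request \<Theta> (Ms b) (Ms (\<not> b)) (length bs) (a # c' # bs @ ds) [z]"
      by (auto simp: implication_request_def)
    from closed[OF PI xs this]
    show "\<exists>a'\<in>C b. hold (Ms b) LR [a, a'] \<and> tp \<Theta> (Ms b) a' bs = tp \<Theta> (Ms (\<not> b)) c' ds"
      by (auto simp: implication_request_def C_def)
  next
    fix a x bs b c ds
    assume mem: "{a, x} \<union> set bs \<subseteq> C b" "{c} \<union> set ds \<subseteq> C (\<not> b)"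
      and len: "length bs = length ds" and sub: "tp \<Theta> (Ms b) a bs \<subseteq> tp \<Theta> (Ms (\<not> b)) c ds"
      and E: "hold (Ms b) LE [a, x]"
    have "x \<in> seqs (Ms b)" and xs: "set (a # c # (bs @ [x]) @ ds) \<subseteq> C0" using mem by (auto simp: C_def)
    from step_existential[OF ne this(1) len sub E] obtain z where
      "existential_request \<Theta> (Ms b) (Ms (\<not> b)) (length (bs @ [x])) (a # c # (bs @ [x]) @ ds) [z]"
      by (auto simp: existential_request_def)
    from closed[OF PE xs this]
    show "\<exists>y\<in>C (\<not> b). hold (Ms (\<not> b)) LE [c, y] \<and>
        tp \<Theta> (Ms b) a (bs @ [x]) \<subseteq> tp \<Theta> (Ms (\<not> b)) c (ds @ [y])"
      by (auto simp: existential_request_def C_def)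
  next
    fix a bs b c c' y ds
    assume mem: "{a} \<union> set bs \<subseteq> C b" "{c, c', y} \<union> set ds \<subseteq> C (\<not> b)"
      and len: "length bs = length ds" and sub: "tp \<Theta> (Ms b) a bs \<subseteq> tp \<Theta> (Ms (\<not> b)) c ds"
      and R: "hold (Ms (\<not> b)) LR [c, c']" and E: "hold (Ms (\<not> b)) LE [c', y]"
    have "c' \<in> seqs (Ms (\<not> b))" "y \<in> seqs (Ms (\<not> b))"
      and xs: "set (a # c' # bs @ (ds @ [y])) \<subseteq> C0" using mem by (auto simp: C_def)
    from step_universal[OF ne this(1,2) len sub R E] obtain z x where
      "universal_request \<Theta> (Ms b) (Ms (\<not> b)) (length bs) (a # c' # bs @ (ds @ [y])) [z, x]"
      by (auto simp: universal_request_def)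
    from closed[OF PU xs this]
    show "\<exists>a'\<in>C b. \<exists>x\<in>C b. hold (Ms b) LR [a, a'] \<and> hold (Ms b) LE [a', x] \<and>
        tp \<Theta> (Ms b) a' (bs @ [x]) \<subseteq> tp \<Theta> (Ms (\<not> b)) c' (ds @ [y])"
      by (auto simp: universal_request_def C_def) blast
  qed
  moreover have "S \<inter> seqs (Ms b) \<subseteq> C b" for b using C0(2) by (auto simp: C_def)
  ultimately show ?thesis by (rule that)
qed

end

section \<open>Translations\<close>

lemma letters_ST:
  "l \<in> letters (ST pr i k) \<Longrightarrow> l = LR \<or> l = LE \<or> l \<in> pr ` set_ifm i"
  by (induction i arbitrary: k) auto

lemma ST_map_ifm: "(\<And>l. l \<in> set_ifm i \<Longrightarrow> pr (q l) = pr' l) \<Longrightarrow> ST pr (map_ifm q i) k = ST pr' i k"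
  by (induction i arbitrary: k) auto

lemma wf_map_ifm: "(\<And>l. l \<in> set_ifm i \<Longrightarrow> ar (q l) = ar' l) \<Longrightarrow> wf_ifm ar (map_ifm q i) = wf_ifm ar' i"
  by (induction i) auto

lemma ifv_map_ifm: "ifv (map_ifm q i) = ifv i"
  by (induction i) auto

lemma finite_letters: "finite (letters f)"
  by (induction f) auto

section \<open>Separation of points by finitely many intuitionistic formulas\<close>

abbreviation forced :: "'u model \<times> (var \<Rightarrow> 'u) \<Rightarrow> letter ifm \<Rightarrow> bool" where
  "forced p i \<equiv> force (fst p) i (snd p (X 0)) (\<lambda>j. snd p (W j))"

text \<open>Otherwise \<phi> would be \<open>K\<close>-equivalent to a disjunction of conjunctions:
  one disjunct for each set of formulas of \<open>I\<close> that is exactly the forced part of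
  \<open>I\<close> at some point satisfying \<phi>.\<close>

lemma separating_points:
  fixes K :: "'u model set"
  assumes "finite I" "I \<subseteq> Form \<Theta> n" and \<Theta>: "\<Theta> = Sigma_of {\<phi>}"
    and no: "\<And>i. i \<in> Form \<Theta> n \<Longrightarrow> \<not> K_equivalent K \<phi> (ST (\<lambda>l. l) i 0)"
  defines "pts b \<equiv> {p. fst p \<in> K \<and> voc (fst p) = \<Theta> \<and> assignment (fst p) (snd p) \<and>
    sat (fst p) (snd p) \<phi> = b}"
  shows "\<exists>p\<in>pts True. \<exists>q\<in>pts False. \<forall>i\<in>I. forced p i \<longrightarrow> forced q i"
proof (rule ccontr)
  assume "\<not> ?thesis"
  then have sep: "\<exists>i\<in>I. forced p i \<and> \<not> forced q i" if "p \<in> pts True" "q \<in> pts False" for p q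
    using that by blast
  \<comment> \<open>There may be infinitely many points, but they realize only finitely many subsets
    of \<open>I\<close>.\<close>
  define \<S> where "\<S> = (\<lambda>p. {i\<in>I. forced p i}) ` pts True"
  have \<S>: "\<S> \<subseteq> Pow I" by (auto simp: \<S>_def)
  have "\<exists>\<chi>\<in>Form \<Theta> n. \<forall>(M :: 'u model) a e. force M \<chi> a e \<longleftrightarrow> (\<forall>i\<in>J. force M i a e)" if "J \<in> \<S>" for J
  proof -
    have "finite J" "J \<subseteq> Form \<Theta> n" using that \<S> assms(1,2) finite_subset by blast+
    then show ?thesis by (rule finite_conjunction) blast
  qed
  then obtain \<chi> where \<chi>: "\<And>J. J \<in> \<S> \<Longrightarrow> \<chi> J \<in> Form \<Theta> n"
    "\<And>J (M :: 'u model) a e. J \<in> \<S> \<Longrightarrow> force M (\<chi> J) a e \<longleftrightarrow> (\<forall>i\<in>J. force M i a e)" by metis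
  have "finite (\<chi> ` \<S>)" using \<S> assms(1) by (meson finite_Pow_iff finite_imageI finite_subset)
  moreover have "\<chi> ` \<S> \<subseteq> Form \<Theta> n" using \<chi>(1) by blast
  ultimately obtain \<psi> where \<psi>: "\<psi> \<in> Form \<Theta> n"
    "\<And>(M :: 'u model) a e. force M \<psi> a e \<longleftrightarrow> (\<exists>i\<in>\<chi> ` \<S>. force M i a e)"
    by (rule finite_disjunction) blast
  have \<psi>_iff: "forced p \<psi> \<longleftrightarrow> (\<exists>J\<in>\<S>. \<forall>i\<in>J. forced p i)" for p :: "'u model \<times> (var \<Rightarrow> 'u)"
    by (simp add: \<psi>(2) \<chi>(2))
  have pos: "forced p \<psi>" if "p \<in> pts True" for p
  proof -
    have "{i\<in>I. forced p i} \<in> \<S>" using that by (simp add: \<S>_def)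
    then show ?thesis unfolding \<psi>_iff by (rule rev_bexI) simp
  qed
  have neg: "\<not> forced q \<psi>" if "q \<in> pts False" for q
  proof
    assume "forced q \<psi>"
    then obtain J where J: "J \<in> \<S>" "\<forall>i\<in>J. forced q i" unfolding \<psi>_iff by (elim bexE)
    from J(1) obtain p where p: "p \<in> pts True" "J = {i\<in>I. forced p i}"
      unfolding \<S>_def by (elim imageE)
    from sep[OF p(1) that] J(2) p(2) show False by auto
  qed
  have "letters (ST (\<lambda>l. l) \<psi> 0) \<subseteq> \<Theta>"
    using letters_ST[of _ "\<lambda>l. l" \<psi> 0] \<psi>(1) unfolding \<Theta> Form_def Sigma_of_def by fastforce
  \<comment> \<open>Satisfiability refers to models of exactly the vocabulary of the set, so both
    sets must have vocabulary \<Theta>, the one used in \<open>pts\<close>.\<close>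
  then have voc: "Sigma_of ({\<phi>} \<union> {Neg (ST (\<lambda>l. l) \<psi> 0)}) = \<Theta>"
    "Sigma_of ({ST (\<lambda>l. l) \<psi> 0} \<union> {Neg \<phi>}) = \<Theta>"
    by (auto simp: \<Theta> Sigma_of_def)
  have "\<not> (sat M s \<phi> \<and> \<not> sat M s (ST (\<lambda>l. l) \<psi> 0))" "\<not> (\<not> sat M s \<phi> \<and> sat M s (ST (\<lambda>l. l) \<psi> 0))"
    if "M \<in> K" "voc M = \<Theta>" "assignment M s" for M s
    using pos[of "(M, s)"] neg[of "(M, s)"] that by (auto simp: pts_def sat_ST)
  then have "K_equivalent K \<phi> (ST (\<lambda>l. l) \<psi> 0)"
    unfolding K_equivalent_def K_follows_def K_satisfiable_def voc by auto
  with no \<psi>(1) show False by blast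
qed

theorem theorem5:
  fixes K :: "'u model set"
    and ar :: "'p \<Rightarrow> nat" and pr :: "'p \<Rightarrow> letter"
    and \<phi> :: fm and n :: nat
  assumes "infinite (UNIV :: 'u set)"
    and "letter_map ar pr"
    and "\<forall>M\<in>K. is_model M"
    and "\<forall>\<Theta>. vocabulary \<Theta> \<and> finite \<Theta> \<longrightarrow> axiomatizable K \<Theta>"
    and "wf_fm \<phi>" and "fv \<phi> \<subseteq> insert (X 0) (W ` {..<n})"
    and "K_invariant K n \<phi>"
  shows "\<exists>i. wf_ifm ar i \<and> ifv i \<subseteq> {..<n} \<and> K_equivalent K \<phi> (ST pr i 0)"
proof (rule ccontr)
  assume contra: "\<not> ?thesis"
  define \<Theta> where "\<Theta> = Sigma_of {\<phi>}"
  have voc\<Theta>: "vocabulary \<Theta>" "finite \<Theta>"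
    by (simp_all add: \<Theta>_def Sigma_of_def vocabulary_def finite_letters)
  have "\<exists>p. pr p = l" if "l \<notin> {LR, LE}" for l
  proof -
    have "l \<in> range pr" using assms(2) that by (auto simp: letter_map_def)
    then show ?thesis by auto
  qed
  \<comment> \<open>A right inverse of \<open>pr\<close>, from surjectivity. It renames formulas
    over \<Sigma> into formulas over the given letters without changing their translations.\<close>
  then obtain q where q: "\<And>l. l \<notin> {LR, LE} \<Longrightarrow> pr (q l) = l" by metis
  have "arity (pr p) = Suc (ar p)" for p using assms(2) by (simp add: letter_map_def)
  then have ar: "ar p = arity (pr p) - 1" for p by simp
  have no: "\<not> K_equivalent K \<phi> (ST (\<lambda>l. l) i 0)" if i: "i \<in> Form \<Theta> n" for i
  proof -
    have pr: "pr (q l) = l" if "l \<in> set_ifm i" for l using i that by (intro q) (auto simp: Form_def)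
    have "wf_ifm ar (map_ifm q i)"
      using i wf_map_ifm[of i ar q "\<lambda>l. arity l - 1"] pr by (simp add: ar Form_def)
    moreover have "ifv (map_ifm q i) \<subseteq> {..<n}" using i by (simp add: ifv_map_ifm Form_def)
    moreover have "ST pr (map_ifm q i) 0 = ST (\<lambda>l. l) i 0" using pr by (rule ST_map_ifm)
    ultimately show ?thesis using contra by metis
  qed
  define pts where "pts b = {p. fst p \<in> K \<and> voc (fst p) = \<Theta> \<and> assignment (fst p) (snd p) \<and>
    sat (fst p) (snd p) \<phi> = b}" for b
  \<comment> \<open>The finite sets of formulas with code below \<open>k\<close> exhaust
    \<open>Form \<Theta> n\<close> as \<open>k\<close> grows.\<close>
  have "\<exists>r. fst r \<in> pts True \<and> snd r \<in> pts False \<and>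
    (\<forall>i\<in>{i \<in> Form \<Theta> n. to_nat i < k}. forced (fst r) i \<longrightarrow> forced (snd r) i)" for k
  proof -
    have "finite {i :: letter ifm. to_nat i < k}"
      using finite_vimageI[OF finite_lessThan inj_to_nat] by (simp add: vimage_def lessThan_def)
    then have "finite {i \<in> Form \<Theta> n. to_nat i < k}" by (rule rev_finite_subset) auto
    then have "\<exists>p\<in>pts True. \<exists>q\<in>pts False. \<forall>i\<in>{i \<in> Form \<Theta> n. to_nat i < k}. forced p i \<longrightarrow> forced q i"
      unfolding pts_def by (rule separating_points[OF _ _ \<Theta>_def no]) auto
    then show ?thesis by (elim bexE, intro exI[of _ "(_, _)"]) simp
  qed
  then have "\<forall>k. \<exists>r. fst r \<in> pts True \<and> snd r \<in> pts False \<and>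
    (\<forall>i\<in>{i \<in> Form \<Theta> n. to_nat i < k}. forced (fst r) i \<longrightarrow> forced (snd r) i)" by (rule allI)
  from choice[OF this] obtain r where r: "\<forall>k. fst (r k) \<in> pts True \<and> snd (r k) \<in> pts False \<and>
    (\<forall>i\<in>{i \<in> Form \<Theta> n. to_nat i < k}. forced (fst (r k)) i \<longrightarrow> forced (snd (r k)) i)"
    by (rule exE)
  define p where "p b k = (if b then fst (r k) else snd (r k))" for b k
  have p: "p b k \<in> pts b" for b k using r[rule_format, of k] by (cases b) (simp_all add: p_def)
  have trans: "forced (p False k) i"
    if "i \<in> Form \<Theta> n" "to_nat i < k" "forced (p True k) i" for i k
    using r[rule_format, of k] that by (simp add: p_def)
  define Ms where "Ms b k = fst (p b k)" for b k
  define ss where "ss b k = snd (p b k)" for b k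
  have Ms: "Ms b k \<in> K" "voc (Ms b k) = \<Theta>" "assignment (Ms b k) (ss b k)" "sat (Ms b k) (ss b k) \<phi> \<longleftrightarrow> b"
    for b k using p[of b k] by (auto simp: pts_def Ms_def ss_def)
  define a where "a b k = ss b k (X 0)" for b k
  define bs where "bs b = map (\<lambda>j k. ss b k (W j)) [0..<n]" for b
  have seqs: "a b \<in> seqs (Ms b)" "set (bs b) \<subseteq> seqs (Ms b)" for b
    using Ms(3) by (simp_all add: assignment_def seqs_def a_def bs_def image_subset_iff)
  have len: "length (bs b) = n" for b by (simp add: bs_def)
  obtain U where "free_ultrafilter U" using ex_free_ultrafilter by blast
  then interpret free_ultrafilter U .
  let ?S = "\<Union>b. insert (a b) (set (bs b))"
  have "countable ?S" by (intro countable_UN countable_insert countable_finite) auto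
  moreover have "?S \<inter> seqs (Ms b) \<noteq> {}" for b using seqs by blast
  moreover have "is_model (Ms b k)" for b k using Ms(1) assms(3) by blast
  ultimately obtain C h where "ultraproduct_pair U Ms \<Theta> C h" and C: "\<And>b. ?S \<inter> seqs (Ms b) \<subseteq> C b"
    using ex_ultraproduct_pair[OF assms(1), of Ms \<Theta> ?S] Ms(2) by blast
  then interpret P: ultraproduct_pair U Ms \<Theta> C h by simp
  have mem: "{a b} \<union> set (bs b) \<subseteq> C b" for b using C[of b] seqs[of b] by blast
  have force_bs: "force (Ms b k) i (a b k) (\<lambda>j. (bs b ! j) k) \<longleftrightarrow> forced (p b k) i" if "i \<in> Form \<Theta> n" for b k i
    unfolding a_def ss_def Ms_def[symmetric] by (rule force_cong_Form[OF that]) (simp add: bs_def ss_def)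
  have tp: "i \<in> tp \<Theta> (Ms b) (a b) (bs b) \<longleftrightarrow>
      i \<in> Form \<Theta> n \<and> eventually (\<lambda>k. forced (p b k) i) U" for b i
    by (cases "i \<in> Form \<Theta> n") (simp_all add: tp_def uforce_def len force_bs)
  have "tp \<Theta> (Ms True) (a True) (bs True) \<subseteq> tp \<Theta> (Ms False) (a False) (bs False)"
  proof (rule subsetI, unfold tp, elim conjE, intro conjI)
    \<comment> \<open>The formula is preserved at every coordinate above its code, hence almost
      everywhere because \<open>U\<close> is free.\<close>
    fix i assume i: "i \<in> Form \<Theta> n" and "eventually (\<lambda>k. forced (p True k) i) U"
    from this(2) eventually_gt[of "to_nat i"] show "eventually (\<lambda>k. forced (p False k) i) U"
      by eventually_elim (rule trans[OF i])
  qed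
  then have asim: "asimulation (P.S.fin True) (h True (a True)) (map (h True) (bs True))
      (P.S.fin False) (h False (a False)) (map (h False) (bs False)) P.A"
    by (intro P.asimulation_A mem) (simp_all add: len)
  have fin_K: "P.S.fin b \<in> K" for b
    using assms(4) voc\<Theta> Ms(1) by (intro P.S.fin_in_axiomatizable) auto
  have point: "point (P.S.fin b) (h b (a b)) (map (h b) (bs b))" for b
    using mem[of b] P.S.model_fin by (auto simp: point_def P.S.Dom_fin)
  have sat: "sat_at (P.S.fin b) (h b (a b)) (map (h b) (bs b)) \<phi> \<longleftrightarrow> b" for b
  proof -
    \<comment> \<open>An assignment by sequences that represents the point; the default
      \<open>a b\<close> keeps its range in \<open>C b\<close>, as Los's theorem requires.\<close>
    define \<sigma> where "\<sigma> v = (case v of X _ \<Rightarrow> a b | W j \<Rightarrow> if j < n then bs b ! j else a b)" for v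
    have eq: "sat (Ms b k) (\<lambda>w. \<sigma> w k) \<phi> \<longleftrightarrow> b" for k
    proof -
      have "sat (Ms b k) (\<lambda>w. \<sigma> w k) \<phi> \<longleftrightarrow> sat (Ms b k) (ss b k) \<phi>"
        by (rule sat_cong) (use assms(6) in \<open>auto simp: \<sigma>_def a_def bs_def\<close>)
      with Ms(4) show ?thesis by simp
    qed
    have "\<sigma> v \<in> C b" for v
      using mem[of b] by (cases v) (auto simp: \<sigma>_def len dest: nth_mem)
    then have \<sigma>: "range \<sigma> \<subseteq> C b" by blast
    then have "assignment (P.S.fin b) (h b \<circ> \<sigma>)" by (auto simp: assignment_def P.S.Dom_fin)
    then have "sat_at (P.S.fin b) (h b (a b)) (map (h b) (bs b)) \<phi> \<longleftrightarrow> sat (P.S.fin b) (h b \<circ> \<sigma>) \<phi>"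
      by (rule sat_at_iff) (use assms(6) in \<open>simp_all add: \<sigma>_def len\<close>)
    also have "\<dots> \<longleftrightarrow> eventually (\<lambda>k. sat (Ms b k) (\<lambda>w. \<sigma> w k) \<phi>) U"
      by (rule P.S.los[OF \<sigma>])
    finally show ?thesis by (simp add: eq eventually_const nontrivial)
  qed
  have "vocabulary \<Theta> \<and> Sigma_of {\<phi>} \<subseteq> \<Theta> \<and> P.S.fin True \<in> K \<and> P.S.fin False \<in> K \<and>
      voc (P.S.fin True) = \<Theta> \<and> voc (P.S.fin False) = \<Theta> \<and>
      point (P.S.fin True) (h True (a True)) (map (h True) (bs True)) \<and>
      point (P.S.fin False) (h False (a False)) (map (h False) (bs False)) \<and>
      length (map (h True) (bs True)) = n \<and> length (map (h False) (bs False)) = n \<and>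
      (\<exists>A. asimulation (P.S.fin True) (h True (a True)) (map (h True) (bs True))
        (P.S.fin False) (h False (a False)) (map (h False) (bs False)) A) \<and>
      sat_at (P.S.fin True) (h True (a True)) (map (h True) (bs True)) \<phi>"
    using voc\<Theta>(1) fin_K point asim sat[of True] by (auto simp: \<Theta>_def[symmetric] P.S.voc_fin len)
  then have "sat_at (P.S.fin False) (h False (a False)) (map (h False) (bs False)) \<phi>"
    by (rule assms(7)[unfolded K_invariant_def, rule_format])
  with sat[of False] show False by simp
qed

end
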